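(* Let $d\ge 1$ be an integer, $0<\alpha<1$ and $M>0$. Consider the problem $$\begin{cases}u_t=\nabla\cdot(u^\alpha\nabla v)&\text{in }(0,+\infty)\times\mathbb R^d,\\ -\Delta v=u&\text{in }(0,+\infty)\times\mathbb R^d,\\ u(t,x),\,v(t,x)\to0&\text{as }|x|\to+\infty,\\ u=u_0&\text{at }t=0.\end{cases}$$ The self-similar solution of total mass $M$ of this problem is given by $$U_M(t,x)=t^{-\frac1\alpha}\left(\alpha+\left(\frac{\omega_d|x|^d\,t^{-\frac1\alpha}}{\alpha M}\right)^{\frac{\alpha}{1-\alpha}}\right)^{-\frac1\alpha}.$$
   Context: $\omega_d$ is the volume of the unit ball of $\mathbb R^d$. A self-similar solution is a solution of the form $U(t,x)=t^{-\gamma}F(|x|\,t^{-\beta})$; in order to satisfy the equation and conserve mass one takes $\gamma=\frac1\alpha$ and $\beta=\frac1{\alpha d}$. Total mass $M$ means $\int_{\mathbb R^d}U_M(t,x)\,dx=M$. The initial datum $u_0$ of this solution is a Dirac delta (of mass $M$, at the origin).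
   Formalization: For d = 1, 2 no v with −Δv = u ≥ 0, u ≠ 0 tends to 0 at infinity, so there v → 0 is replaced by v(t,x)/Φ(x) → M as |x| → ∞, where Φ is the fundamental solution of −Δ (−|x|/2 for d = 1, −log|x|/(2π) for d = 2). *)

theory Defs
  imports "HOL-Probability.Probability"
begin

text \<open>The space \<open>\<real>\<^sup>d\<close> is an arbitrary Euclidean space \<open>'a\<close> with \<open>d = DIM('a)\<close>.\<close>

text \<open>The trace of the Frechet derivative of a vector field.\<close>

definition has_divergence :: "('a::euclidean_space \<Rightarrow> 'a) \<Rightarrow> real \<Rightarrow> 'a \<Rightarrow> bool" where
  "has_divergence W D x \<longleftrightarrow>
     (\<exists>W'. (W has_derivative W') (at x) \<and> D = (\<Sum>b\<in>Basis. W' b \<bullet> b))"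

text \<open>The fundamental solution of \<open>-\<Delta>\<close> in dimensions 1 and 2. It is only used there.\<close>

definition low_dim_fundamental_solution :: "'a::euclidean_space \<Rightarrow> real" where
  "low_dim_fundamental_solution x =
     (if DIM('a) = 1 then - norm x / 2 else - ln (norm x) / (2 * pi))"

text \<open>The requirement \<open>v \<rightarrow> 0\<close> at infinity, for a potential \<open>v\<close> of the integrable density \<open>w \<ge> 0\<close>.
  In dimensions 1 and 2 a superharmonic function vanishing at infinity is zero, so the requirement
  cannot hold literally unless \<open>w = 0\<close>. Its usual replacement is that \<open>v\<close> behaves at infinity as
  the Newtonian potential of the total mass of \<open>w\<close>, which fixes \<open>v\<close> up to an additive constant
  and hence fixes \<open>\<nabla>v\<close>.\<close>

definition potential_at_infinity :: "('a::euclidean_space \<Rightarrow> real) \<Rightarrow> ('a \<Rightarrow> real) \<Rightarrow> bool" where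
  "potential_at_infinity w v \<longleftrightarrow>
     (if DIM('a) \<ge> 3 then (v \<longlongrightarrow> 0) at_infinity
      else ((\<lambda>x. v x / low_dim_fundamental_solution x) \<longlongrightarrow> (LINT x|lborel. w x)) at_infinity)"

text \<open>The initial datum is a measure, attained in the sense of narrow convergence.\<close>

definition has_initial_datum ::
    "(real \<Rightarrow> 'a::euclidean_space \<Rightarrow> real) \<Rightarrow> 'a measure \<Rightarrow> bool" where
  "has_initial_datum u u0 \<longleftrightarrow>
     (\<forall>\<phi>::'a \<Rightarrow> real. continuous_on UNIV \<phi> \<and> bounded (range \<phi>) \<longrightarrow>
        ((\<lambda>t. LINT x|lborel. \<phi> x * u t x) \<longlongrightarrow> (LINT x|u0. \<phi> x)) (at_right 0))"

text \<open>Nonnegative classical solutions of the problem; \<open>G t\<close> is the gradient of \<open>v t\<close>.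
  Only the values for \<open>t > 0\<close> matter. It is not assumed that \<open>u\<close> is differentiable in \<open>x\<close>:
  the self-similar solution need not be at the origin, whereas the flux always is.\<close>

definition solves_problem ::
    "real \<Rightarrow> 'a::euclidean_space measure \<Rightarrow> (real \<Rightarrow> 'a \<Rightarrow> real) \<Rightarrow> (real \<Rightarrow> 'a \<Rightarrow> real) \<Rightarrow> bool" where
  "solves_problem \<alpha> u0 u v \<longleftrightarrow>
     continuous_on ({0<..} \<times> UNIV) (\<lambda>(t, x). u t x) \<and>
     (\<forall>t>0. (\<forall>x. u t x \<ge> 0) \<and> integrable lborel (u t)) \<and>
     (\<exists>G. \<forall>t>0. \<forall>x.
        GDERIV (v t) x :> G t x \<and>
        has_divergence (G t) (- u t x) x \<and>
        (\<exists>D. has_divergence (\<lambda>y. (u t y powr \<alpha>) *\<^sub>R G t y) D x \<and>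
             ((\<lambda>s. u s x) has_real_derivative D) (at t))) \<and>
     (\<forall>t>0. (u t \<longlongrightarrow> 0) at_infinity \<and> potential_at_infinity (u t) (v t)) \<and>
     has_initial_datum u u0"

definition self_similar :: "(real \<Rightarrow> 'a::euclidean_space \<Rightarrow> real) \<Rightarrow> bool" where
  "self_similar u \<longleftrightarrow>
     (\<exists>\<gamma> \<beta> F. \<forall>t>0. \<forall>x. u t x = t powr (- \<gamma>) * F (norm x * t powr (- \<beta>)))"

definition self_similar_solution ::
    "real \<Rightarrow> real \<Rightarrow> (real \<Rightarrow> 'a::euclidean_space \<Rightarrow> real) \<Rightarrow> bool" where
  "self_similar_solution \<alpha> M u \<longleftrightarrow>
     self_similar u \<and>
     (\<exists>v. solves_problem \<alpha> (scale_measure (ennreal M) (return borel 0)) u v) \<and>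
     (\<forall>t>0. (LINT x|lborel. u t x) = M)"

end

theory Submission
  imports Defs
begin

text \<open>The density of a self-similar solution is radial, so its mass in the ball of radius \<open>r\<close>, call it
  \<open>m(t, r)\<close>, determines a radial potential. A Liouville argument shows that it is the only potential
  with the prescribed behaviour at infinity, up to a constant; hence \<open>\<nabla>v = - m x / (d \<omega>\<^sub>d r\<^sup>d)\<close>.
  Conservation of mass forces \<open>\<gamma> = d\<beta>\<close>, and then the equation at time \<open>t\<close> is the derivative of
  \<open>u\<^sup>\<alpha> m = \<kappa> y u\<close>, where \<open>y = \<omega>\<^sub>d r\<^sup>d\<close> and \<open>\<kappa> = d\<beta> / t\<close>. As \<open>u\<close> is the derivative of \<open>m\<close> with
  respect to \<open>y\<close>, this is a separable ordinary differential equation for \<open>m\<close>. Its only solution with limit \<open>M\<close>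
  is explicit, and comparing its values at the origin at two times gives \<open>d\<beta> = 1 / \<alpha>\<close>.
  Conversely, for the explicit profile the flux \<open>u\<^sup>\<alpha> \<nabla>v\<close> collapses to \<open>- u x / (\<alpha> d t)\<close>.\<close>

section \<open>Divergence and the maximum principle\<close>

text \<open>Low regularity shapes the argument. The potential has only pointwise second derivatives,
  so mean value properties are out of reach and the Liouville argument runs through an elementary
  maximum principle: on large balls when d \<ge> 3, and on annuli against the fundamental solution
  when d \<le> 2, where only the growth of the potential is prescribed. The density is not assumed
  differentiable in space, so self-similarity has to turn its time derivative into a radial one. The
  differential equation is degenerate as well: \<open>u powr \<alpha> * m = \<kappa> * y * u\<close>
  holds wherever u vanishes, so u could a priori be zero in some places and follow the explicit
  profile in others. Connectedness of the set where m is positive excludes this. The number \<kappa>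
  stays free until the end, because a single time does not determine d\<beta>. The value at the
  origin is \<open>\<kappa> powr (1 / \<alpha>)\<close>, which scales in time with the exponent
  -1/\<alpha>, while self-similarity prescribes the exponent -d\<beta>.\<close>

lemma has_divergence_diff:
  assumes "has_divergence V D x" and "has_divergence W E x"
  shows "has_divergence (\<lambda>y. V y - W y) (D - E) x"
proof -
  obtain V' W' where "(V has_derivative V') (at x)" "D = (\<Sum>b\<in>Basis. V' b \<bullet> b)"
    and "(W has_derivative W') (at x)" "E = (\<Sum>b\<in>Basis. W' b \<bullet> b)"
    using assms unfolding has_divergence_def by blast
  then show ?thesis
    unfolding has_divergence_def
    by (intro exI[of _ "\<lambda>h. V' h - W' h"])
      (auto intro: has_derivative_diff simp: inner_diff_left sum_subtractf)
qed

lemma has_divergence_scaleR: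
  assumes "has_divergence V D x"
  shows "has_divergence (\<lambda>y. c *\<^sub>R V y) (c * D) x"
proof -
  obtain V' where "(V has_derivative V') (at x)" "D = (\<Sum>b\<in>Basis. V' b \<bullet> b)"
    using assms unfolding has_divergence_def by blast
  then show ?thesis
    unfolding has_divergence_def
    by (intro exI[of _ "\<lambda>h. c *\<^sub>R V' h"])
      (auto intro: has_derivative_scaleR_right simp: sum_distrib_left)
qed

lemma has_divergence_ident: "has_divergence (\<lambda>y::'a::euclidean_space. y) (real DIM('a)) x"
  unfolding has_divergence_def
  by (intro exI[of _ "\<lambda>h. h"]) (simp add: inner_same_Basis)

lemma has_divergence_unique:
  assumes "has_divergence V D x" and "has_divergence V E x"
  shows "D = E"
  using assms has_derivative_unique unfolding has_divergence_def by metis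

text \<open>The derivative is \<open>A (norm x)\<close> times the identity plus a rank one map built
  from \<open>sgn x\<close> and x; the trace of the latter is
  \<open>A' * (sgn x \<bullet> x)\<close>, that is \<open>A' * norm x\<close>.\<close>

lemma has_divergence_radial:
  fixes x :: "'a::euclidean_space" and A :: "real \<Rightarrow> real"
  assumes x: "x \<noteq> 0" and A: "(A has_real_derivative A') (at (norm x))"
  shows "has_divergence (\<lambda>y. A (norm y) *\<^sub>R y) (DIM('a) * A (norm x) + norm x * A') x"
proof -
  have "((\<lambda>y. A (norm y)) has_derivative (\<lambda>h. A' * (h \<bullet> sgn x))) (at x)"
    using has_derivative_compose[OF has_derivative_norm[OF x] A[unfolded has_field_derivative_def]]
    by simp
  from has_derivative_scaleR[OF this has_derivative_ident]
  have "((\<lambda>y. A (norm y) *\<^sub>R y) has_derivative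
      (\<lambda>h. A (norm x) *\<^sub>R h + (A' * (h \<bullet> sgn x)) *\<^sub>R x)) (at x)" .
  moreover have "(\<Sum>b\<in>Basis. (A' * (b \<bullet> sgn x)) * (x \<bullet> b)) = A' * (sgn x \<bullet> x)"
    by (subst euclidean_inner[of "sgn x"]) (simp add: sum_distrib_left inner_commute mult_ac)
  moreover have "sgn x \<bullet> x = norm x"
    using x by (simp add: sgn_div_norm dot_square_norm power2_eq_square)
  ultimately show ?thesis
    unfolding has_divergence_def
    by (intro exI[of _ "\<lambda>h. A (norm x) *\<^sub>R h + (A' * (h \<bullet> sgn x)) *\<^sub>R x"])
      (simp add: inner_add_left inner_same_Basis sum.distrib)
qed

lemma filterlim_norm_at_right_0: "filterlim norm (at_right 0) (at (0::'a::real_normed_vector))"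
  by (auto simp: filterlim_at eventually_at_filter intro!: tendsto_eq_intros)

text \<open>The factor y absorbs one order: the remainder divided by \<open>norm y\<close> is
  \<open>\<bar>A (norm y) - a\<bar>\<close>, so a limit of the coefficient suffices. Hence the field
  and the flux are differentiable at the origin even where the density is not.\<close>

lemma has_divergence_radial_0:
  fixes A :: "real \<Rightarrow> real" and a :: real
  assumes A: "(A \<longlongrightarrow> a) (at_right 0)"
  shows "has_divergence (\<lambda>y::'a::euclidean_space. A (norm y) *\<^sub>R y) (DIM('a) * a) 0"
proof -
  have "((\<lambda>y::'a. A (norm y)) \<longlongrightarrow> a) (at 0)"
    by (rule filterlim_compose[OF A filterlim_norm_at_right_0])
  then have "((\<lambda>y::'a. norm (A (norm y) - a)) \<longlongrightarrow> 0) (at 0)"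
    by (rule tendsto_norm_zero[OF LIM_zero])
  moreover have "\<forall>\<^sub>F y::'a in at 0. norm (A (norm y) - a) =
      norm (A (norm y) *\<^sub>R y - A (norm 0) *\<^sub>R 0 - a *\<^sub>R (y - 0)) / norm (y - 0)"
    by (auto simp: eventually_at_filter simp flip: scaleR_diff_left)
  ultimately have "((\<lambda>y::'a. A (norm y) *\<^sub>R y) has_derivative (\<lambda>h. a *\<^sub>R h)) (at 0)"
    unfolding has_derivative_iff_norm
    by (auto intro: bounded_linear_scaleR_right Lim_transform_eventually)
  then show ?thesis
    unfolding has_divergence_def
    by (intro exI[of _ "\<lambda>h. a *\<^sub>R h"]) (auto simp: inner_same_Basis)
qed

text \<open>A converse to \<open>has_divergence_radial\<close>, which recovers regularity of the
  coefficient from the field: restrict to the ray through x, project on its direction and divide by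
  the distance.\<close>

lemma radial_has_real_derivative:
  fixes x :: "'a::euclidean_space" and A :: "real \<Rightarrow> real"
  assumes r: "norm x > 0" and D: "has_divergence (\<lambda>y. A (norm y) *\<^sub>R y) D x"
  obtains A' where "(A has_real_derivative A') (at (norm x))"
    "D = DIM('a) * A (norm x) + norm x * A'"
proof -
  let ?W = "\<lambda>y::'a. A (norm y) *\<^sub>R y" and ?e = "sgn x"
  have x: "norm x *\<^sub>R ?e = x" and ne: "norm ?e = 1" and ee: "?e \<bullet> ?e = 1"
    using r by (auto simp: sgn_div_norm dot_square_norm norm_sgn)
  obtain W' where W': "(?W has_derivative W') (at (norm x *\<^sub>R ?e))"
    using D unfolding has_divergence_def x by blast
  have "((\<lambda>s. s *\<^sub>R ?e) has_derivative (\<lambda>h. h *\<^sub>R ?e)) (at (norm x))"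
    by (auto intro!: derivative_eq_intros)
  from has_derivative_compose[OF this W']
  have "((\<lambda>s. ?W (s *\<^sub>R ?e)) has_derivative (\<lambda>h. W' (h *\<^sub>R ?e))) (at (norm x))" .
  from has_derivative_inner_left[OF this, of ?e]
  have "((\<lambda>s. ?W (s *\<^sub>R ?e) \<bullet> ?e) differentiable (at (norm x)))"
    unfolding differentiable_def by blast
  then have "(\<lambda>s. (?W (s *\<^sub>R ?e) \<bullet> ?e) / s) differentiable (at (norm x))"
    using r by (intro differentiable_divide) auto
  then obtain A' where "((\<lambda>s. (?W (s *\<^sub>R ?e) \<bullet> ?e) / s) has_real_derivative A') (at (norm x))"
    using real_differentiable_def by blast
  then have A': "(A has_real_derivative A') (at (norm x))"
    by (rule has_field_derivative_transform_within_open[where S="{0<..}"])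
      (use r ne ee in auto)
  moreover have "D = DIM('a) * A (norm x) + norm x * A'"
    using has_divergence_unique[OF D has_divergence_radial[OF _ A']] r by auto
  ultimately show ?thesis using that by blast
qed

text \<open>Only pointwise second derivatives are available: no continuity of the Laplacian is used.\<close>

lemma strict_subharmonic_no_interior_max:
  fixes h :: "'a::euclidean_space \<Rightarrow> real"
  assumes S: "open S" "x \<in> S" and G: "\<And>y. y \<in> S \<Longrightarrow> GDERIV h y :> G y"
    and D: "has_divergence G D x" "D > 0"
    and max: "\<And>y. y \<in> S \<Longrightarrow> h y \<le> h x"
  shows False
proof -
  obtain G' where G': "(G has_derivative G') (at x)" "D = (\<Sum>b\<in>Basis. G' b \<bullet> b)"
    using D unfolding has_divergence_def by blast
  \<comment> \<open>The trace is positive, so some diagonal entry is; the rest of the proof lives on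
    the line through x in that direction.\<close>
  obtain b where b: "b \<in> Basis" "G' b \<bullet> b > 0"
    using D(2) sum_nonpos[of Basis "\<lambda>b. G' b \<bullet> b"] unfolding G'(2) by force
  obtain e where e: "e > 0" "ball x e \<subseteq> S"
    using S openE by blast
  have inS: "x + s *\<^sub>R b \<in> S" if "\<bar>s\<bar> < e" for s
    using that e b by (intro subsetD[OF e(2)]) (auto simp: dist_norm)
  define \<phi> where "\<phi> s = h (x + s *\<^sub>R b)" for s
  define \<psi> where "\<psi> s = G (x + s *\<^sub>R b) \<bullet> b" for s
  have line: "((\<lambda>s. x + s *\<^sub>R b) has_derivative (\<lambda>k. k *\<^sub>R b)) (at s)" for s
    by (auto intro!: derivative_eq_intros)
  have d1: "(\<phi> has_real_derivative \<psi> s) (at s)" if "\<bar>s\<bar> < e" for s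
    using has_derivative_compose[OF line, OF G[OF inS[OF that], unfolded gderiv_def]]
    unfolding \<phi>_def \<psi>_def has_field_derivative_def by (simp add: inner_commute mult_commute_abs)
  have "((\<lambda>s. G (x + s *\<^sub>R b)) has_derivative (\<lambda>k. G' (k *\<^sub>R b))) (at 0)"
    by (rule has_derivative_compose[OF line]) (use G' in simp)
  from has_derivative_inner_left[OF this, of b]
  have d2: "(\<psi> has_real_derivative (G' b \<bullet> b)) (at 0)"
    unfolding \<psi>_def has_field_derivative_def
    using has_derivative_linear[OF G'(1)] by (simp add: linear_cmul mult_commute_abs)
  \<comment> \<open>A maximum makes the slope vanish at 0, and the positive derivative of the slope
    makes it positive just to the right, so \<open>\<phi>\<close> would increase beyond its
    maximum.\<close>
  have "\<psi> 0 = 0"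
    by (rule DERIV_local_max[OF d1 e(1)]) (use e max inS in \<open>auto simp: \<phi>_def\<close>)
  with DERIV_pos_inc_right[OF d2 b(2)]
  obtain d where d: "d > 0" "\<And>k. 0 < k \<Longrightarrow> k < d \<Longrightarrow> 0 < \<psi> k"
    by auto
  define s where "s = min d e / 2"
  have s: "0 < s" "s < d" "s < e"
    using d e by (auto simp: s_def)
  have "\<phi> 0 < \<phi> s"
  proof (rule DERIV_pos_imp_increasing_open[OF s(1)])
    show "continuous_on {0..s} \<phi>"
      using d1 s by (intro DERIV_atLeastAtMost_imp_continuous_on) force
  qed (use d1 d s in force)
  moreover have "\<phi> s \<le> \<phi> 0"
    using max[OF inS[of s]] s by (simp add: \<phi>_def)
  ultimately show False by simp
qed

lemma GDERIV_norm_power2: "GDERIV (\<lambda>y::'a::euclidean_space. (norm y)\<^sup>2) x :> 2 *\<^sub>R x"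
  unfolding gderiv_def power2_norm_eq_inner
  by (auto intro!: derivative_eq_intros simp: inner_commute)

lemma GDERIV_continuous_on:
  assumes "\<And>x. x \<in> S \<Longrightarrow> GDERIV h x :> G x"
  shows "continuous_on S h"
  using assms unfolding gderiv_def
  by (metis continuous_at_imp_continuous_on has_derivative_continuous)

text \<open>Adding \<open>e * (norm y)\<^sup>2\<close> raises the Laplacian by 2 e d > 0, so the
  perturbed function cannot attain its maximum in the interior. The perturbation is bounded on the
  compact set and vanishes as e tends to 0.\<close>

lemma subharmonic_maximum_principle:
  fixes h :: "'a::euclidean_space \<Rightarrow> real"
  assumes S: "compact S" and G: "\<And>y. y \<in> S \<Longrightarrow> GDERIV h y :> G y"
    and D: "\<And>y. y \<in> S \<Longrightarrow> \<exists>D\<ge>0. has_divergence G D y"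
    and le: "\<And>y. y \<in> S \<Longrightarrow> y \<notin> interior S \<Longrightarrow> h y \<le> B"
    and x: "x \<in> S"
  shows "h x \<le> B"
proof -
  obtain R where R: "\<And>y. y \<in> S \<Longrightarrow> norm y \<le> R"
    using compact_imp_bounded[OF S] bounded_iff by blast
  have "h x \<le> B + e * R\<^sup>2" if e: "e > 0" for e
  proof -
    \<comment> \<open>The gradient is written as a difference, with a double minus, to match
      \<open>has_divergence_diff\<close>.\<close>
    let ?h = "\<lambda>y. h y + e * (norm y)\<^sup>2" and ?G = "\<lambda>y. G y - (- 2 * e) *\<^sub>R y"
    have G': "GDERIV ?h y :> ?G y" if "y \<in> S" for y
      using GDERIV_add[OF G[OF that] GDERIV_mult[OF GDERIV_const GDERIV_norm_power2, of e]]
      by (simp add: mult.commute)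
    obtain z where z: "z \<in> S" "\<And>y. y \<in> S \<Longrightarrow> ?h y \<le> ?h z"
      using continuous_attains_sup[OF S _ GDERIV_continuous_on[OF G']] x by blast
    have "z \<notin> interior S"
    proof
      assume zi: "z \<in> interior S"
      obtain D where D': "D \<ge> 0" "has_divergence G D z"
        using D z(1) by blast
      have div: "has_divergence ?G (D - (- 2 * e) * DIM('a)) z"
        by (intro has_divergence_diff D' has_divergence_scaleR has_divergence_ident)
      have pos: "D - (- 2 * e) * DIM('a) > 0"
        using D'(1) e by (simp add: add_nonneg_pos)
      show False
        using strict_subharmonic_no_interior_max[of "interior S" z ?h ?G, OF open_interior zi G' div pos z(2)]
          interior_subset[of S] by blast
    qed
    then have "h z \<le> B"
      using le z(1) by blast
    moreover have "e * (norm z)\<^sup>2 \<le> e * R\<^sup>2"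
      using e R[OF z(1)] by (intro mult_left_mono power_mono) auto
    moreover have "h x \<le> ?h x"
      using e by simp
    ultimately show ?thesis
      using z(2)[OF x] by linarith
  qed
  note bnd = this
  show ?thesis
  proof (rule field_le_epsilon)
    fix d :: real assume "d > 0"
    \<comment> \<open>The denominator carries + 1 so that R = 0 is harmless.\<close>
    then have "h x \<le> B + d / (R\<^sup>2 + 1) * R\<^sup>2"
      by (intro bnd) (auto intro!: divide_pos_pos add_nonneg_pos)
    also have "d / (R\<^sup>2 + 1) * R\<^sup>2 \<le> d / (R\<^sup>2 + 1) * (R\<^sup>2 + 1)"
      using \<open>d > 0\<close> by (intro mult_left_mono) (auto intro!: divide_nonneg_nonneg)
    also have "d / (R\<^sup>2 + 1) * (R\<^sup>2 + 1) = d"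
      by (simp add: add_nonneg_eq_0_iff)
    finally show "h x \<le> B + d" by simp
  qed
qed

section \<open>Liouville theorems and uniqueness of the gradient of the potential\<close>

lemma GDERIV_radial:
  fixes x :: "'a::euclidean_space" and \<Psi> :: "real \<Rightarrow> real"
  assumes "x \<noteq> 0" and "(\<Psi> has_real_derivative norm x * A) (at (norm x))"
  shows "GDERIV (\<lambda>y. \<Psi> (norm y)) x :> A *\<^sub>R x"
  using GDERIV_DERIV_compose[OF GDERIV_norm assms(2)] assms(1)
  by (simp add: sgn_div_norm field_simps)

text \<open>On an annulus around the origin, h is compared with
  \<open>h 0 + d + e * (\<Psi> (norm y) - \<Psi> r)\<close>, where \<open>\<Psi>\<close> is harmonic
  there and grows without bound. Continuity at 0 controls the inner sphere, and h = o(\<Psi>)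
  controls a large outer one. Then e and d tend to 0.\<close>

lemma harmonic_le_center_low_dim:
  fixes h :: "'a::euclidean_space \<Rightarrow> real"
  assumes dim: "DIM('a) \<le> 2"
    and G: "\<And>y. GDERIV h y :> G y" and D: "\<And>y. has_divergence G 0 y"
    and lim: "((\<lambda>y. h y / low_dim_fundamental_solution y) \<longlongrightarrow> 0) at_infinity"
  shows "h x \<le> h 0"
proof (cases "x = 0")
  case False
  define \<Psi> :: "real \<Rightarrow> real" where "\<Psi> r = (if DIM('a) = 1 then r else ln r)" for r
  define c :: real where "c = (if DIM('a) = 1 then 2 else 2 * pi)"
  have c: "c > 0"
    by (simp add: c_def)
  have dims: "DIM('a) = 1 \<or> DIM('a) = 2"
    using dim DIM_positive[where 'a='a] by linarith
  have low: "low_dim_fundamental_solution y = - \<Psi> (norm y) / c" for y :: 'a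
    by (simp add: low_dim_fundamental_solution_def \<Psi>_def c_def)
  have \<Psi>_top: "filterlim \<Psi> at_top at_top"
    unfolding \<Psi>_def using ln_at_top filterlim_ident by (cases "DIM('a) = 1") (auto simp: id_def)
  \<comment> \<open>This form covers the derivatives 1 for d = 1 and 1/r for d = 2 at once; the
    gradient is x divided by \<open>norm x ^ DIM('a)\<close> in both cases.\<close>
  have \<Psi>_deriv: "(\<Psi> has_real_derivative r * (1 / r ^ DIM('a))) (at r)" if "r > 0" for r
    using dims
  proof
    assume "DIM('a) = 1"
    then show ?thesis using that by (simp add: \<Psi>_def[abs_def])
  next
    assume "DIM('a) = 2"
    then show ?thesis using that DERIV_ln[OF that]
      by (simp add: \<Psi>_def[abs_def] power2_eq_square field_simps)
  qed
  define \<Phi> where "\<Phi> y = (1 / norm y ^ DIM('a)) *\<^sub>R y" for y :: 'a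
  have \<Phi>: "GDERIV (\<lambda>y. \<Psi> (norm y)) y :> \<Phi> y" if "y \<noteq> 0" for y :: 'a
    unfolding \<Phi>_def using that by (intro GDERIV_radial \<Psi>_deriv) auto
  have \<Phi>_div: "has_divergence \<Phi> 0 y" if "y \<noteq> 0" for y :: 'a
  proof -
    have "((\<lambda>r. 1 / r ^ DIM('a)) has_real_derivative - (DIM('a) * norm y ^ (DIM('a) - 1)) / (norm y ^ DIM('a) * norm y ^ DIM('a)))
        (at (norm y))"
      using that by (auto intro!: derivative_eq_intros)
    from has_divergence_radial[OF that this] show ?thesis
      unfolding \<Phi>_def[abs_def] using dims that by (auto simp: field_simps power2_eq_square)
  qed
  have "h x \<le> h 0 + d" if d: "d > 0" for d
  proof -
    have "isCont h 0"
      using G[of 0] unfolding gderiv_def by (rule has_derivative_continuous)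
    then obtain r0 where r0: "r0 > 0" "\<And>y. norm y < r0 \<Longrightarrow> \<bar>h y - h 0\<bar> < d"
      using d unfolding continuous_at_eps_delta by (auto simp: dist_norm)
    define r where "r = min r0 (norm x) / 2"
    have r: "0 < r" "r < norm x" "r < r0"
      using r0(1) False by (auto simp: r_def min_def)
    have bound: "h x \<le> h 0 + d + e * (\<Psi> (norm x) - \<Psi> r)" if e: "e > 0" for e
    proof -
      obtain R1 where R1: "\<And>y. norm y \<ge> R1 \<Longrightarrow> \<bar>h y / low_dim_fundamental_solution y\<bar> < e * c / 2"
        using tendstoD[OF lim, of "e * c / 2"] e c unfolding eventually_at_infinity by auto
      \<comment> \<open>The bound 1 makes \<open>\<Psi> R\<close> positive, for the division on the
        outer sphere. The other bound lets half of \<open>e * \<Psi> R\<close> absorb the constants,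
        the first half being spent on \<open>\<bar>h y\<bar>\<close>.\<close>
      obtain R2 where R2: "\<And>s. s \<ge> R2 \<Longrightarrow> \<Psi> s \<ge> max 1 (2 * (e * \<Psi> r - h 0 - d) / e)"
        using \<Psi>_top unfolding filterlim_at_top eventually_at_top_linorder by metis
      define R where "R = Max {R1, R2, norm x + 1}"
      have R: "R \<ge> R1" "R \<ge> R2" "R > norm x"
        by (auto simp: R_def)
      have \<Psi>R: "\<Psi> R \<ge> 1" "2 * (e * \<Psi> r - h 0 - d) \<le> e * \<Psi> R"
        using R2[OF R(2)] e by (auto simp: pos_divide_le_eq mult.commute)
      have outer: "h y \<le> h 0 + d + e * (\<Psi> R - \<Psi> r)" if "norm y = R" for y
      proof -
        have "\<bar>h y / (- \<Psi> R / c)\<bar> < e * c / 2"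
          using R1[of y] R(1) that by (simp add: low)
        then have "\<bar>h y\<bar> * c / \<Psi> R < e * c / 2"
          using \<Psi>R(1) c by (simp add: abs_mult)
        then have "\<bar>h y\<bar> * c < e * c / 2 * \<Psi> R"
          using \<Psi>R(1) by (subst (asm) pos_divide_less_eq) auto
        then have "\<bar>h y\<bar> * c < (e / 2 * \<Psi> R) * c"
          by (simp add: mult_ac)
        then have "\<bar>h y\<bar> < e / 2 * \<Psi> R"
          using c by (simp only: mult_less_cancel_right_pos)
        then show ?thesis
          using \<Psi>R(2) by (simp add: algebra_simps)
      qed
      define S where "S = cball (0::'a) R - ball 0 r"
      have S: "compact S"
        by (simp add: S_def compact_diff)
      have "ball 0 R - cball 0 r \<subseteq> interior S"
        by (intro interior_maximal) (auto simp: S_def open_Diff)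
      then have edge: "norm y = r \<or> norm y = R" if "y \<in> S" "y \<notin> interior S" for y
        using that by (force simp: S_def)
      let ?k = "\<lambda>y. h y - e * \<Psi> (norm y)" and ?K = "\<lambda>y. G y - e *\<^sub>R \<Phi> y"
      have "?k x \<le> h 0 + d - e * \<Psi> r"
      proof (rule subharmonic_maximum_principle[OF S])
        fix y assume y: "y \<in> S"
        then have "y \<noteq> 0"
          using r by (auto simp: S_def)
        show "GDERIV ?k y :> ?K y"
          using GDERIV_diff[OF G GDERIV_mult[OF GDERIV_const \<Phi>[OF \<open>y \<noteq> 0\<close>], of e]]
          by simp
        show "\<exists>D\<ge>0. has_divergence ?K D y"
          using has_divergence_diff[OF D has_divergence_scaleR[OF \<Phi>_div[OF \<open>y \<noteq> 0\<close>], of e]]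
          by auto
        assume "y \<notin> interior S"
        from edge[OF y this] show "?k y \<le> h 0 + d - e * \<Psi> r"
          using outer[of y] r0(2)[of y] r(3) by (auto simp: algebra_simps)
      qed (use r R in \<open>auto simp: S_def\<close>)
      then show ?thesis
        by (simp add: algebra_simps)
    qed
    have "((\<lambda>e. h 0 + d + e * (\<Psi> (norm x) - \<Psi> r)) \<longlongrightarrow> h 0 + d + 0 * (\<Psi> (norm x) - \<Psi> r)) (at_right 0)"
      by (intro tendsto_intros)
    moreover have "\<forall>\<^sub>F e in at_right 0. h x \<le> h 0 + d + e * (\<Psi> (norm x) - \<Psi> r)"
      using bound by (auto simp: eventually_at_filter)
    ultimately show ?thesis
      using tendsto_lowerbound[of _ _ "at_right (0::real)"] by fastforce
  qed
  then show ?thesis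
    by (rule field_le_epsilon)
qed simp

lemma harmonic_nonpos_high_dim:
  fixes h :: "'a::euclidean_space \<Rightarrow> real"
  assumes G: "\<And>y. GDERIV h y :> G y" and D: "\<And>y. has_divergence G 0 y"
    and lim: "(h \<longlongrightarrow> 0) at_infinity"
  shows "h x \<le> 0"
proof (rule field_le_epsilon)
  fix e :: real assume "e > 0"
  then obtain R1 where R1: "\<And>y. norm y \<ge> R1 \<Longrightarrow> \<bar>h y\<bar> < e"
    using tendstoD[OF lim, of e] unfolding eventually_at_infinity by auto
  define R where "R = max R1 (norm x)"
  have "h x \<le> e"
  proof (rule subharmonic_maximum_principle[of "cball (0::'a) R"])
    fix y :: 'a assume "y \<in> cball 0 R" "y \<notin> interior (cball 0 R)"
    then have "norm y = R"
      by simp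
    then show "h y \<le> e"
      using R1[of y] by (simp add: R_def)
  qed (use G D in \<open>auto simp: R_def\<close>)
  then show "h x \<le> 0 + e" by simp
qed

lemma potential_gradient_unique:
  fixes v w :: "'a::euclidean_space \<Rightarrow> real"
  assumes V: "\<And>y. GDERIV v y :> V y" "\<And>y. has_divergence V (- f y) y"
    and W: "\<And>y. GDERIV w y :> W y" "\<And>y. has_divergence W (- f y) y"
    and inf: "potential_at_infinity f v" "potential_at_infinity f w"
  shows "V x = W x"
proof -
  \<comment> \<open>A one-sided bound stated for arbitrary pairs, so that exchanging the two
    potentials gives the reverse inequality. The bound depends on the dimension, but either way the
    difference is constant.\<close>
  have dir: "v1 y - v2 y \<le> (if DIM('a) \<ge> 3 then 0 else v1 0 - v2 0)"
    if V: "\<And>y. GDERIV v1 y :> V1 y" "\<And>y. has_divergence V1 (- f y) y"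
      and W: "\<And>y. GDERIV v2 y :> V2 y" "\<And>y. has_divergence V2 (- f y) y"
      and inf: "potential_at_infinity f v1" "potential_at_infinity f v2" for v1 v2 V1 V2 y
  proof -
    have G: "GDERIV (\<lambda>y. v1 y - v2 y) y :> V1 y - V2 y" for y
      by (intro GDERIV_diff V W)
    have D: "has_divergence (\<lambda>y. V1 y - V2 y) 0 y" for y
      using has_divergence_diff[OF V(2) W(2), of y] by simp
    show ?thesis
    proof (cases "DIM('a) \<ge> 3")
      case True
      then have "((\<lambda>y. v1 y - v2 y) \<longlongrightarrow> 0 - 0) at_infinity"
        using inf unfolding potential_at_infinity_def by (intro tendsto_diff) auto
      then show ?thesis
        using harmonic_nonpos_high_dim[OF G D] True by simp
    next
      case False
      let ?I = "LINT x|lborel. f x"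
      have "((\<lambda>y. v1 y / low_dim_fundamental_solution y - v2 y / low_dim_fundamental_solution y)
          \<longlongrightarrow> ?I - ?I) at_infinity"
        using inf False unfolding potential_at_infinity_def by (intro tendsto_diff) auto
      then have "((\<lambda>y. (v1 y - v2 y) / low_dim_fundamental_solution y) \<longlongrightarrow> 0) at_infinity"
        by (simp add: diff_divide_distrib)
      then show ?thesis
        using harmonic_le_center_low_dim[OF _ G D] False by auto
    qed
  qed
  have "v y - w y = v 0 - w 0" for y
    using dir[OF V W inf, of y] dir[OF W V inf(2,1), of y]
      dir[OF V W inf, of 0] dir[OF W V inf(2,1), of 0] by (auto split: if_splits)
  then have "(\<lambda>y. v y - w y) = (\<lambda>y. v 0 - w 0)"
    by blast
  moreover have "GDERIV (\<lambda>y. v y - w y) x :> V x - W x"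
    by (intro GDERIV_diff V W)
  ultimately have "GDERIV (\<lambda>y. v 0 - w 0) x :> V x - W x"
    by simp
  \<comment> \<open>The derivative of a constant vanishes in every direction, in particular in the
    direction \<open>V x - W x\<close>.\<close>
  then have "(\<lambda>h. h \<bullet> (V x - W x)) = (\<lambda>h. 0)"
    unfolding gderiv_def using has_derivative_unique has_derivative_const by blast
  then have "(V x - W x) \<bullet> (V x - W x) = 0"
    by metis
  then show ?thesis by simp
qed

section \<open>Radial densities and their potentials\<close>

lemma emeasure_cball_unit_ball:
  assumes "r \<ge> 0"
  shows "emeasure lborel (cball (0::'a::euclidean_space) r) =
    ennreal (measure lborel (ball (0::'a) 1) * r ^ DIM('a))"
proof -
  have "emeasure lborel (cball (0::'a) r) = ennreal (measure lborel (cball (0::'a) r))"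
    using emeasure_lborel_cball_finite[of "0::'a" r] by (simp add: emeasure_eq_ennreal_measure)
  then show ?thesis
    using content_cball_conv_ball[of "0::'a" r] content_ball_conv_unit_ball[OF assms, of "0::'a"]
    by (simp add: mult.commute)
qed

lemma unit_ball_measure_pos: "measure lborel (ball (0::'a::euclidean_space) 1) > 0"
  using content_ball_pos[of 1 "0::'a"] by simp

text \<open>Integration in polar coordinates for radial functions. The half-lines
  \<open>{..r}\<close> form a generator stable under intersection, and on them both sides are the
  volume of a ball, since \<open>\<omega> * r ^ d\<close> differentiates to the density.\<close>

lemma distr_norm_lborel:
  "distr lborel borel (norm :: 'a::euclidean_space \<Rightarrow> real) =
    density lborel (\<lambda>s. ennreal (DIM('a) * measure lborel (ball (0::'a) 1) * s ^ (DIM('a) - 1)) * indicator {0..} s)"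
  (is "?M = ?N")
proof (rule measure_eqI_generator_eq)
  let ?\<omega> = "measure lborel (ball (0::'a) 1)"
  show "Int_stable (range (atMost :: real \<Rightarrow> real set))"
    by (auto simp: Int_stable_def)
  have borel: "sets borel = sigma_sets UNIV (range (atMost :: real \<Rightarrow> real set))"
    by (subst borel_eq_atMost) simp
  then show "sets ?M = sigma_sets UNIV (range atMost)" "sets ?N = sigma_sets UNIV (range atMost)"
    by simp_all
  have M: "emeasure ?M {..r} = (if r \<ge> 0 then ennreal (?\<omega> * r ^ DIM('a)) else 0)" for r
  proof -
    have "emeasure ?M {..r} = emeasure lborel (cball (0::'a) r)"
      by (subst emeasure_distr) (auto simp: vimage_def cball_def dist_norm intro!: arg_cong[of _ _ "emeasure lborel"])
    then show ?thesis
      by (auto simp: emeasure_cball_unit_ball)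
  qed
  fix X assume "X \<in> range (atMost :: real \<Rightarrow> real set)"
  then obtain r where X: "X = {..r}" by blast
  have "emeasure ?N {..r} = (\<integral>\<^sup>+s. ennreal (DIM('a) * ?\<omega> * s ^ (DIM('a) - 1)) * indicator {0..r} s \<partial>lborel)"
    by (subst emeasure_density) (auto intro!: nn_integral_cong simp: indicator_def)
  also have "\<dots> = (if r \<ge> 0 then ennreal (?\<omega> * r ^ DIM('a)) else 0)"
  proof (cases "r \<ge> 0")
    case True
    have "((\<lambda>s. DIM('a) * ?\<omega> * s ^ (DIM('a) - 1)) has_integral ?\<omega> * r ^ DIM('a) - ?\<omega> * 0 ^ DIM('a)) {0..r}"
      by (rule fundamental_theorem_of_calculus[OF True])
        (auto intro!: derivative_eq_intros simp flip: has_real_derivative_iff_has_vector_derivative)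
    then show ?thesis
      using True by (subst nn_integral_has_integral_lebesgue') (auto simp: unit_ball_measure_pos less_imp_le zero_power)
  qed auto
  finally show "emeasure ?M X = emeasure ?N X"
    by (simp add: M X)
next
  show "(\<Union>i::nat. {..real i}) = UNIV"
    using real_arch_simple by auto
  show "emeasure ?M {..real i} \<noteq> \<infinity>" for i :: nat
    using emeasure_lborel_cball_finite[of "0::'a" "real i"]
    by (subst emeasure_distr) (auto simp: vimage_def cball_def dist_norm less_top)
qed auto

text \<open>Radial functions matter only for r \<ge> 0, so the derivative at 0 is one-sided.\<close>

lemma half_line_antiderivative:
  fixes g :: "real \<Rightarrow> real"
  assumes "continuous_on {0..} g"
  obtains I where "I 0 = 0" "\<And>r. r \<ge> 0 \<Longrightarrow> (I has_real_derivative g r) (at r within {0..})"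
proof (rule that[of "\<lambda>r. integral {0..r} g"])
  show "integral {0..0} g = 0" by simp
  fix r :: real assume "r \<ge> 0"
  then have "((\<lambda>r. integral {0..r} g) has_real_derivative g r) (at r within {0..r + 1})"
    by (intro integral_has_real_derivative continuous_on_subset[OF assms]) auto
  moreover have "at r within {0..r + 1} = at r within {0..}"
    by (rule at_within_nhd[where S = "{..<r + 1}"]) auto
  ultimately show "((\<lambda>r. integral {0..r} g) has_real_derivative g r) (at r within {0..})"
    by simp
qed

lemma half_line_derivative_at:
  assumes "r > 0" and "(I has_field_derivative D) (at r within {0..})"
  shows "(I has_field_derivative D) (at (r::real))"
proof -
  have "at r within {0..} = at r"
    using assms(1) by (intro at_within_interior) simp
  then show ?thesis using assms(2) by simp
qed

text \<open>The mass function m is fixed by a differential equation instead of an integral, so that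
  both an abstract antiderivative and the explicit \<open>profile_mass\<close> can take its place.
  That it is the mass of balls is \<open>nn_integral_cball\<close>.\<close>

locale radial_density =
  fixes u :: "'a::euclidean_space \<Rightarrow> real" and f m :: "real \<Rightarrow> real" and \<omega> :: real
  defines "\<omega> \<equiv> measure lborel (ball (0::'a) 1)"
  assumes u: "\<And>x. u x = f (norm x)"
    and f_cont: "continuous_on {0..} f" and f_nonneg: "\<And>r. r \<ge> 0 \<Longrightarrow> f r \<ge> 0"
    and m_0: "m 0 = 0" and m_cont: "continuous_on {0..} m"
    and m_deriv: "\<And>r. r > 0 \<Longrightarrow> (m has_real_derivative DIM('a) * \<omega> * r ^ (DIM('a) - 1) * f r) (at r)"
begin

lemma omega_pos: "\<omega> > 0"
  unfolding \<omega>_def by (rule unit_ball_measure_pos)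

lemma m_mono:
  assumes "0 \<le> r" "r \<le> s"
  shows "m r \<le> m s"
proof (cases "r = s")
  case False
  show ?thesis
  proof (rule DERIV_nonneg_imp_increasing_open[OF assms(2)])
    fix x assume "r < x" "x < s"
    then have x: "x > 0"
      using assms by simp
    have "DIM('a) * \<omega> * x ^ (DIM('a) - 1) * f x \<ge> 0"
      using x omega_pos f_nonneg[of x] by simp
    with m_deriv[OF x] show "\<exists>y. (m has_real_derivative y) (at x) \<and> y \<ge> 0"
      by blast
  qed (use assms continuous_on_subset[OF m_cont] in auto)
qed simp

lemma m_nonneg: "r \<ge> 0 \<Longrightarrow> m r \<ge> 0"
  using m_mono[of 0 r] m_0 by simp

lemma nn_integral_cball:
  assumes r: "r \<ge> 0"
  shows "(\<integral>\<^sup>+x. ennreal (u x) * indicator (cball 0 r) x \<partial>lborel) = ennreal (m r)"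
proof -
  \<comment> \<open>Nothing is known about f on negative numbers; the constant extension makes it
    continuous, hence measurable, on the whole line.\<close>
  let ?f = "\<lambda>s. f (max 0 s)"
  have "continuous_on UNIV ?f"
    by (rule continuous_on_compose2[OF f_cont]) (auto intro!: continuous_intros)
  then have meas[measurable]: "?f \<in> borel_measurable borel"
    by (rule borel_measurable_continuous_onI)
  have "(\<integral>\<^sup>+x. ennreal (u x) * indicator (cball 0 r) x \<partial>lborel) =
      (\<integral>\<^sup>+x. ennreal (?f (norm x)) * indicator {..r} (norm x) \<partial>(lborel :: 'a measure))"
    by (intro nn_integral_cong) (auto simp: u indicator_def)
  also have "\<dots> = (\<integral>\<^sup>+s. ennreal (?f s) * indicator {..r} s \<partial>distr lborel borel (norm :: 'a \<Rightarrow> real))"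
    by (rule nn_integral_distr[symmetric]) auto
  also have "\<dots> = (\<integral>\<^sup>+s. ennreal (DIM('a) * \<omega> * s ^ (DIM('a) - 1)) * indicator {0..} s *
      (ennreal (?f s) * indicator {..r} s) \<partial>lborel)"
    unfolding distr_norm_lborel \<omega>_def by (rule nn_integral_density) auto
  also have "\<dots> = (\<integral>\<^sup>+s. ennreal (DIM('a) * \<omega> * s ^ (DIM('a) - 1) * f s) * indicator {0..r} s \<partial>lborel)"
    using omega_pos f_nonneg
    by (intro nn_integral_cong) (auto simp: indicator_def ennreal_mult)
  also have "\<dots> = ennreal (m r - m 0)"
  proof (rule nn_integral_has_integral_lebesgue')
    show "((\<lambda>s. DIM('a) * \<omega> * s ^ (DIM('a) - 1) * f s) has_integral m r - m 0) {0..r}"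
      using m_deriv
      by (intro fundamental_theorem_of_calculus_interior r continuous_on_subset[OF m_cont])
        (auto simp flip: has_real_derivative_iff_has_vector_derivative)
  qed (use omega_pos f_nonneg in auto)
  finally show ?thesis
    by (simp add: m_0)
qed

lemma u_measurable [measurable]: "u \<in> borel_measurable borel"
proof -
  have "u = (\<lambda>x. f (norm x))"
    using u by blast
  moreover have "continuous_on UNIV (\<lambda>x::'a. f (norm x))"
    by (rule continuous_on_compose2[OF f_cont]) (auto intro!: continuous_intros)
  ultimately show ?thesis
    by (auto intro: borel_measurable_continuous_onI)
qed

lemma u_nonneg: "u x \<ge> 0"
  by (simp add: u f_nonneg)

lemma nn_integral_SUP: "(\<integral>\<^sup>+x. ennreal (u x) \<partial>lborel) = (SUP i::nat. ennreal (m (real i)))"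
proof -
  have "(\<integral>\<^sup>+x. ennreal (u x) \<partial>lborel) =
      (\<integral>\<^sup>+x. (SUP i::nat. ennreal (u x) * indicator (cball 0 (real i)) x) \<partial>lborel)"
  proof (intro nn_integral_cong antisym)
    fix x :: 'a
    obtain i :: nat where "norm x \<le> real i"
      using real_arch_simple by blast
    then show "ennreal (u x) \<le> (SUP i::nat. ennreal (u x) * indicator (cball 0 (real i)) x)"
      by (intro SUP_upper2[of i]) auto
  qed (auto intro!: SUP_least simp: indicator_def)
  also have "\<dots> = (SUP i::nat. (\<integral>\<^sup>+x. ennreal (u x) * indicator (cball 0 (real i)) x \<partial>lborel))"
    by (rule nn_integral_monotone_convergence_SUP)
      (auto simp: incseq_def le_fun_def indicator_def)
  finally show ?thesis
    by (simp add: nn_integral_cball)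
qed

lemma has_bochner_integral_of_limit:
  assumes L: "(m \<longlongrightarrow> L) at_top"
  shows "has_bochner_integral lborel u L"
proof -
  have lim: "(\<lambda>i::nat. m (real i)) \<longlonglongrightarrow> L"
    by (rule filterlim_compose[OF L filterlim_real_sequentially])
  have "L \<ge> 0"
    by (rule tendsto_lowerbound[OF lim]) (auto simp: m_nonneg)
  have "(\<lambda>i::nat. ennreal (m (real i))) \<longlonglongrightarrow> ennreal L"
    using lim by (rule tendsto_ennrealI)
  moreover have "(\<lambda>i::nat. ennreal (m (real i))) \<longlonglongrightarrow> (SUP i::nat. ennreal (m (real i)))"
    by (rule LIMSEQ_SUP) (auto simp: incseq_def intro!: ennreal_leI m_mono)
  ultimately have "(\<integral>\<^sup>+x. ennreal (u x) \<partial>lborel) = ennreal L"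
    unfolding nn_integral_SUP by (rule LIMSEQ_unique[symmetric])
  then show ?thesis
    using \<open>L \<ge> 0\<close> u_nonneg by (intro has_bochner_integral_nn_integral) auto
qed

lemma m_le_integral:
  assumes "integrable lborel u" "r \<ge> 0"
  shows "m r \<le> (LINT x|lborel. u x)"
proof -
  have "ennreal (m r) \<le> (\<integral>\<^sup>+x. ennreal (u x) \<partial>lborel)"
    unfolding nn_integral_cball[OF assms(2), symmetric]
    by (intro nn_integral_mono) (auto simp: indicator_def)
  then show ?thesis
    using assms(1) by (subst (asm) nn_integral_eq_integral) (auto simp: u_nonneg integral_nonneg)
qed

lemma m_tendsto:
  assumes int: "integrable lborel u"
  shows "(m \<longlongrightarrow> (LINT x|lborel. u x)) at_top"
proof -
  have "(\<integral>\<^sup>+x. ennreal (u x) \<partial>lborel) = ennreal (LINT x|lborel. u x)"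
    by (rule nn_integral_eq_integral[OF int]) (simp add: u_nonneg)
  moreover have "(\<lambda>i::nat. ennreal (m (real i))) \<longlonglongrightarrow> (SUP i::nat. ennreal (m (real i)))"
    by (rule LIMSEQ_SUP) (auto simp: incseq_def intro!: ennreal_leI m_mono)
  ultimately have "(\<lambda>i::nat. ennreal (m (real i))) \<longlonglongrightarrow> ennreal (LINT x|lborel. u x)"
    unfolding nn_integral_SUP by simp
  then have "(\<lambda>i::nat. m (real i)) \<longlonglongrightarrow> (LINT x|lborel. u x)"
    by (rule tendsto_ennrealD) (auto simp: m_nonneg u_nonneg integral_nonneg)
  \<comment> \<open>Truncation at 0 gives a function monotone on all of the line, for which the
    limit along the integers is the limit.\<close>
  then have "((\<lambda>r. m (max 0 r)) \<longlongrightarrow> (LINT x|lborel. u x)) at_top"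
    by (intro tendsto_at_topI_sequentially_real) (auto simp: mono_def intro!: m_mono)
  moreover have "\<forall>\<^sub>F r in at_top. m (max 0 r) = m r"
    using eventually_ge_at_top[of "0::real"] by eventually_elim simp
  ultimately show ?thesis
    by (rule Lim_transform_eventually)
qed

section \<open>The field given by Gauss's law and its radial potential\<close>

definition A :: "real \<Rightarrow> real" where
  "A r = m r / (DIM('a) * \<omega> * r ^ DIM('a))"

definition field :: "'a \<Rightarrow> 'a" where
  "field x = - (A (norm x) *\<^sub>R x)"

lemma r_power_DIM: "r ^ DIM('a) = r * (r::real) ^ (DIM('a) - 1)"
  by (metis DIM_positive power_eq_if less_numeral_extra(3))

text \<open>Rearranged, d A + r A' = f, which is exactly the divergence that
  \<open>has_divergence_radial\<close> assigns to the field away from the origin, up to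
  sign.\<close>

lemma A_deriv:
  assumes "r > 0"
  shows "(A has_real_derivative (f r - DIM('a) * A r) / r) (at r)"
proof -
  define w where "w = DIM('a) * \<omega>"
  define P where "P = r ^ (DIM('a) - 1)"
  have nz: "w \<noteq> 0" "P \<noteq> 0" "r \<noteq> 0"
    using assms omega_pos by (auto simp: w_def P_def)
  have "((\<lambda>r. m r / (w * r ^ DIM('a))) has_real_derivative
      (w * P * f r * (w * r ^ DIM('a)) - m r * (w * (DIM('a) * P))) /
      ((w * r ^ DIM('a)) * (w * r ^ DIM('a)))) (at r)"
    using nz m_deriv[OF assms] by (auto intro!: derivative_eq_intros simp: w_def P_def)
  moreover have "(w * P * f r * (w * r ^ DIM('a)) - m r * (w * (DIM('a) * P))) /
      ((w * r ^ DIM('a)) * (w * r ^ DIM('a))) = (f r - DIM('a) * A r) / r"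
    using nz unfolding A_def w_def[symmetric] r_power_DIM P_def[symmetric] by (simp add: field_simps)
  ultimately show ?thesis
    by (simp add: A_def[abs_def] w_def)
qed

text \<open>By l'Hopital's rule: the quotient of the derivatives is \<open>f r / DIM('a)\<close>,
  and f is continuous at 0. The value \<open>A 0\<close> itself is the default 0 of division by zero
  and need not be this limit.\<close>

lemma A_tendsto_0: "(A \<longlongrightarrow> f 0 / DIM('a)) (at_right 0)"
  unfolding A_def[abs_def]
proof (rule lhopital_right_0[where f' = "\<lambda>r. DIM('a) * \<omega> * r ^ (DIM('a) - 1) * f r"
      and g' = "\<lambda>r::real. DIM('a) * \<omega> * (DIM('a) * r ^ (DIM('a) - 1))"])
  have [simp]: "(at (0::real) within {0<..}) \<le> at 0 within {0..}"
    by (rule at_le) auto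
  show "(m \<longlongrightarrow> 0) (at_right 0)"
    using m_cont m_0 tendsto_mono[of "at_right 0" "at 0 within {0..}" m 0]
    unfolding continuous_on_def by force
  show "((\<lambda>r. DIM('a) * \<omega> * r ^ DIM('a)) \<longlongrightarrow> 0) (at_right 0)"
    by (auto intro!: tendsto_eq_intros)
  show "\<forall>\<^sub>F r in at_right 0. (m has_real_derivative DIM('a) * \<omega> * r ^ (DIM('a) - 1) * f r) (at r)"
    using m_deriv by (auto simp: eventually_at_filter)
  show "\<forall>\<^sub>F r::real in at_right 0. ((\<lambda>r. DIM('a) * \<omega> * r ^ DIM('a)) has_real_derivative
      DIM('a) * \<omega> * (DIM('a) * r ^ (DIM('a) - 1))) (at r)"
    by (intro always_eventually) (auto intro!: derivative_eq_intros)
  show "\<forall>\<^sub>F r::real in at_right 0. DIM('a) * \<omega> * r ^ DIM('a) \<noteq> 0"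
    using eventually_at_right_less[of "0::real"] by eventually_elim (use omega_pos in simp)
  show "\<forall>\<^sub>F r::real in at_right 0. DIM('a) * \<omega> * (DIM('a) * r ^ (DIM('a) - 1)) \<noteq> 0"
    using eventually_at_right_less[of "0::real"] by eventually_elim (use omega_pos in simp)
  have "(f \<longlongrightarrow> f 0) (at_right 0)"
    using f_cont tendsto_mono[of "at_right 0" "at 0 within {0..}" f "f 0"]
    unfolding continuous_on_def by force
  then have "((\<lambda>r. f r / DIM('a)) \<longlongrightarrow> f 0 / DIM('a)) (at_right 0)"
    by (auto intro!: tendsto_intros)
  moreover have "\<forall>\<^sub>F r::real in at_right 0. f r / DIM('a) =
      DIM('a) * \<omega> * r ^ (DIM('a) - 1) * f r / (DIM('a) * \<omega> * (DIM('a) * r ^ (DIM('a) - 1)))"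
    using eventually_at_right_less[of "0::real"] by eventually_elim (use omega_pos in simp)
  ultimately show "((\<lambda>r::real. DIM('a) * \<omega> * r ^ (DIM('a) - 1) * f r /
      (DIM('a) * \<omega> * (DIM('a) * r ^ (DIM('a) - 1)))) \<longlongrightarrow> f 0 / DIM('a)) (at_right 0)"
    by (rule Lim_transform_eventually)
qed

lemma field_divergence: "has_divergence field (- u x) x"
proof -
  have "has_divergence (\<lambda>y. A (norm y) *\<^sub>R y) (u x) x"
  proof (cases "x = 0")
    case True
    then show ?thesis
      using has_divergence_radial_0[OF A_tendsto_0, where 'a = 'a] by (simp add: u)
  next
    case False
    then show ?thesis
      using has_divergence_radial[OF False A_deriv] by (simp add: u)
  qed
  from has_divergence_scaleR[OF this, of "- 1"] show ?thesis
    by (simp add: field_def[abs_def])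
qed

text \<open>The function \<open>c - I (norm x)\<close> will be the potential. The factor r removes
  the possible jump of A at 0, so the integrand is continuous on the closed half-line.\<close>

lemma obtain_radial_antiderivative:
  obtains I where "I 0 = 0" and "\<And>r. r \<ge> 0 \<Longrightarrow> (I has_real_derivative r * A r) (at r within {0..})"
proof -
  have "continuous_on {0..} (\<lambda>r. r * A r)"
    unfolding continuous_on_def
  proof
    fix r :: real assume "r \<in> {0..}"
    show "((\<lambda>r. r * A r) \<longlongrightarrow> r * A r) (at r within {0..})"
    proof (cases "r = 0")
      case True
      have "((\<lambda>r. r * A r) \<longlongrightarrow> 0 * (f 0 / DIM('a))) (at_right 0)"
        by (intro tendsto_mult A_tendsto_0 tendsto_ident_at)
      moreover have "at (0::real) within {0..} = at_right 0"
        by (auto simp: at_within_def intro!: arg_cong2[of _ _ _ _ inf] arg_cong[of _ _ principal])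
      ultimately show ?thesis
        using True by simp
    next
      case False
      then have "isCont A r"
        using \<open>r \<in> {0..}\<close> by (intro DERIV_isCont[OF A_deriv]) auto
      then have "(A \<longlongrightarrow> A r) (at r within {0..})"
        unfolding isCont_def by (rule tendsto_within_subset) auto
      then show ?thesis
        by (intro tendsto_mult tendsto_ident_at)
    qed
  qed
  then show ?thesis
    using half_line_antiderivative that by blast
qed

lemma radial_potential_GDERIV:
  assumes "I 0 = 0" and I: "\<And>r. r \<ge> 0 \<Longrightarrow> (I has_real_derivative r * A r) (at r within {0..})"
  shows "GDERIV (\<lambda>x. c - I (norm x)) x :> field x"
proof -
  have "GDERIV (\<lambda>x. I (norm x)) x :> A (norm x) *\<^sub>R x"
  proof (cases "x = 0")
    case False
    then show ?thesis
      by (intro GDERIV_radial half_line_derivative_at I) auto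
  next
    case True
    \<comment> \<open>This is the one-sided derivative of I at 0, which is
      \<open>0 * A 0\<close>.\<close>
    have "((\<lambda>r. I r / r) \<longlongrightarrow> 0) (at 0 within {0..})"
      using I[of 0] \<open>I 0 = 0\<close> by (simp add: has_field_derivative_iff)
    then have "((\<lambda>r. I r / r) \<longlongrightarrow> 0) (at_right 0)"
      by (rule tendsto_within_subset) auto
    from filterlim_compose[OF this filterlim_norm_at_right_0]
    have "((\<lambda>y::'a. norm (I (norm y) / norm y)) \<longlongrightarrow> 0) (at 0)"
      by (rule tendsto_norm_zero)
    then show ?thesis
      using True \<open>I 0 = 0\<close> by (simp add: gderiv_def has_derivative_iff_norm abs_divide)
  qed
  from GDERIV_diff[OF GDERIV_const this] show ?thesis
    by (simp add: field_def)
qed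

text \<open>For d \<ge> 3 the antiderivative I increases to a finite limit c, and
  \<open>c - I (norm x)\<close> tends to 0. For d \<le> 2 the potential is
  \<open>- I (norm x)\<close>, whose growth is found by l'Hopital's rule.\<close>

lemma potential_exists:
  assumes int: "integrable lborel u"
  obtains v where "\<And>x. GDERIV v x :> field x" "potential_at_infinity u v"
proof -
  obtain I where I0: "I 0 = 0"
    and I: "\<And>r. r \<ge> 0 \<Longrightarrow> (I has_real_derivative r * A r) (at r within {0..})"
    using obtain_radial_antiderivative by blast
  let ?M = "LINT x|lborel. u x"
  have I': "(I has_real_derivative r * A r) (at r)" if "r > 0" for r
    using half_line_derivative_at I that by auto
  have norm_lim: "filterlim (norm :: 'a \<Rightarrow> real) at_top at_infinity"
    by (rule filterlim_norm_at_top)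
  show ?thesis
  proof (cases "DIM('a) \<ge> 3")
    case True
    \<comment> \<open>For r \<ge> 1 one has r^d \<ge> r^3, so the derivative \<open>r * A r\<close>
      is at most \<open>?K / r\<^sup>2\<close>. Hence \<open>I r + ?K / r\<close> does not increase
      on that range, which bounds I.\<close>
    let ?K = "?M / (DIM('a) * \<omega>)"
    have I_mono: "I r \<le> I s" if "0 \<le> r" "r \<le> s" for r s
    proof (rule DERIV_nonneg_imp_increasing_open[OF that(2)])
      show "continuous_on {r..s} I"
        by (rule continuous_on_subset[of "{0..}"])
          (use that I in \<open>auto intro!: DERIV_continuous_on\<close>)
      fix x assume "r < x" "x < s"
      then have x: "x > 0"
        using that by simp
      then have "x * A x \<ge> 0"
        unfolding A_def using omega_pos m_nonneg[of x] by simp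
      with I'[OF x] show "\<exists>y. (I has_real_derivative y) (at x) \<and> y \<ge> 0"
        by blast
    qed
    have I_bound: "I r \<le> I 1 + ?K" if "r \<ge> 1" for r
    proof -
      have "I r + ?K / r \<le> I 1 + ?K / 1"
      proof (rule DERIV_nonpos_imp_nonincreasing[OF that, where f = "\<lambda>r. I r + ?K / r"])
        fix x :: real assume x: "1 \<le> x" "x \<le> r"
        have "x * A x \<le> x * (?M / (DIM('a) * \<omega> * x ^ 3))"
          unfolding A_def
        proof (rule mult_left_mono[OF frac_le])
          show "m x \<le> ?M"
            by (rule m_le_integral[OF int]) (use x in simp)
          show "DIM('a) * \<omega> * x ^ 3 \<le> DIM('a) * \<omega> * x ^ DIM('a)"
            using x omega_pos True by (intro mult_left_mono power_increasing) auto
        qed (use x omega_pos in \<open>auto simp: u_nonneg integral_nonneg\<close>)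
        also have "\<dots> = ?K / x\<^sup>2"
          using x by (simp add: power2_eq_square power3_eq_cube)
        finally have "x * A x \<le> ?K / x\<^sup>2" .
        moreover have "((\<lambda>r. I r + ?K / r) has_real_derivative x * A x - ?K / x\<^sup>2) (at x)"
          using x omega_pos by (auto intro!: derivative_eq_intros I' simp: power2_eq_square)
        ultimately show "\<exists>y. ((\<lambda>r. I r + ?K / r) has_real_derivative y) (at x) \<and> y \<le> 0"
          by force
      qed
      moreover have "?K / r \<ge> 0"
        using that omega_pos by (auto intro!: divide_nonneg_nonneg simp: u_nonneg integral_nonneg)
      ultimately show ?thesis by simp
    qed
    let ?J = "\<lambda>r. I (max 1 r)"
    have "convergent (\<lambda>i::nat. ?J (real i))"
      by (rule Bseq_mono_convergent, rule BseqI'[of _ "I 1 + ?K"])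
        (use I_mono[of 0] I_mono I_bound I0 in \<open>auto simp: max_def\<close>)
    then obtain c where "(\<lambda>i::nat. ?J (real i)) \<longlonglongrightarrow> c"
      by (auto simp: convergent_def)
    then have "(?J \<longlongrightarrow> c) at_top"
      by (intro tendsto_at_topI_sequentially_real) (auto simp: mono_def intro!: I_mono)
    moreover have "\<forall>\<^sub>F r in at_top. ?J r = I r"
      using eventually_ge_at_top[of "1::real"] by eventually_elim simp
    ultimately have "(I \<longlongrightarrow> c) at_top"
      by (rule Lim_transform_eventually)
    from filterlim_compose[OF this norm_lim]
    have "((\<lambda>x::'a. c - I (norm x)) \<longlongrightarrow> c - c) at_infinity"
      by (intro tendsto_intros)
    then show ?thesis
      using that[OF radial_potential_GDERIV[OF I0 I]] True by (simp add: potential_at_infinity_def)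
  next
    case False
    then have dims: "DIM('a) = 1 \<or> DIM('a) = 2"
      using DIM_positive[where 'a='a] by linarith
    define \<Psi> :: "real \<Rightarrow> real" where "\<Psi> r = (if DIM('a) = 1 then r / 2 else ln r / (2 * pi))" for r
    have \<omega>: "DIM('a) * \<omega> = (if DIM('a) = 1 then 2 else 2 * pi)"
      using dims unfolding \<omega>_def by (auto simp: content_ball unit_ball_vol_2)
    have "((\<lambda>r. I r / \<Psi> r) \<longlongrightarrow> ?M) at_top"
    proof (rule lhospital_at_top_at_top)
      have "filterlim (\<lambda>r::real. 1 / 2 * r) at_top at_top"
        "filterlim (\<lambda>r::real. 1 / (2 * pi) * ln r) at_top at_top"
        by (intro filterlim_tendsto_pos_mult_at_top[OF tendsto_const] filterlim_ident ln_at_top; simp)+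
      then show "filterlim \<Psi> at_top at_top"
        by (cases "DIM('a) = 1") (simp_all add: \<Psi>_def[abs_def])
      \<comment> \<open>One expression for both 1/2 and 1/(2 pi r), because
        \<open>DIM('a) * \<omega>\<close> is 2 or 2 pi. With it the quotient of the derivatives of I
        and \<open>\<Psi>\<close> is exactly \<open>m r\<close>.\<close>
      let ?\<Psi>' = "\<lambda>r::real. r / (DIM('a) * \<omega> * r ^ DIM('a))"
      show "\<forall>\<^sub>F r in at_top. (I has_real_derivative r * A r) (at r)"
        using eventually_gt_at_top[of "0::real"] by eventually_elim (rule I')
      show "\<forall>\<^sub>F r in at_top. (\<Psi> has_real_derivative ?\<Psi>' r) (at r)"
        using eventually_gt_at_top[of "0::real"]
      proof eventually_elim
        case (elim r)
        show ?case
          using dims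
        proof
          assume "DIM('a) = 1"
          then show ?thesis
            using elim \<omega> by (auto simp: \<Psi>_def[abs_def] intro!: derivative_eq_intros)
        next
          assume "DIM('a) = 2"
          then show ?thesis
            using elim \<omega> by (auto simp: \<Psi>_def[abs_def] power2_eq_square intro!: derivative_eq_intros)
        qed
      qed
      show "\<forall>\<^sub>F r in at_top. ?\<Psi>' r \<noteq> 0"
        using eventually_gt_at_top[of "0::real"] by eventually_elim (use omega_pos in auto)
      have "\<forall>\<^sub>F r in at_top. m r = r * A r / ?\<Psi>' r"
        using eventually_gt_at_top[of "0::real"] by eventually_elim (use omega_pos in \<open>auto simp: A_def\<close>)
      with m_tendsto[OF int] show "((\<lambda>r. r * A r / ?\<Psi>' r) \<longlongrightarrow> ?M) at_top"
        by (rule Lim_transform_eventually)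
    qed
    from filterlim_compose[OF this norm_lim]
    have "((\<lambda>x::'a. I (norm x) / \<Psi> (norm x)) \<longlongrightarrow> ?M) at_infinity" .
    moreover have "(0 - I (norm x)) / low_dim_fundamental_solution x = I (norm x) / \<Psi> (norm x)" for x :: 'a
      by (simp add: low_dim_fundamental_solution_def \<Psi>_def)
    ultimately have "((\<lambda>x::'a. (0 - I (norm x)) / low_dim_fundamental_solution x) \<longlongrightarrow> ?M) at_infinity"
      by simp
    then show ?thesis
      using that[OF radial_potential_GDERIV[OF I0 I, of 0]] False by (simp add: potential_at_infinity_def)
  qed
qed

end

section \<open>The profile\<close>

text \<open>The density as a function of the volume y = \<omega> r^d. At time t the formula of the
  theorem is the case \<kappa> = 1/(\<alpha> t); \<kappa> is a parameter because the forward
  direction first knows it only as d\<beta>/t.\<close>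

definition profile :: "real \<Rightarrow> real \<Rightarrow> real \<Rightarrow> real \<Rightarrow> real" where
  "profile \<alpha> M \<kappa> y = ((\<kappa> * y / M) powr (\<alpha> / (1 - \<alpha>)) + 1 / \<kappa>) powr (- 1 / \<alpha>)"

text \<open>The equation u^\<alpha> m = \<kappa> y u solved for m where u > 0.\<close>

definition profile_mass :: "real \<Rightarrow> real \<Rightarrow> real \<Rightarrow> real \<Rightarrow> real" where
  "profile_mass \<alpha> M \<kappa> y = \<kappa> * y * profile \<alpha> M \<kappa> y powr (1 - \<alpha>)"

locale profile_parameters =
  fixes \<alpha> M \<kappa> :: real
  assumes \<alpha>: "0 < \<alpha>" "\<alpha> < 1" and M: "M > 0" and \<kappa>: "\<kappa> > 0"
begin

lemma base_pos: "(\<kappa> * y / M) powr (\<alpha> / (1 - \<alpha>)) + 1 / \<kappa> > 0"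
  using \<kappa> by (simp add: add_nonneg_pos)

lemma profile_pos: "profile \<alpha> M \<kappa> y > 0"
  using base_pos[of y] by (simp add: profile_def)

lemma profile_cont: "continuous_on {0..} (profile \<alpha> M \<kappa>)"
proof -
  have "continuous_on {0..} (\<lambda>y. (\<kappa> * y / M) powr (\<alpha> / (1 - \<alpha>)) + 1 / \<kappa>)"
    using \<alpha> M \<kappa> by (intro continuous_on_add continuous_on_powr' continuous_intros) auto
  then show ?thesis
    unfolding profile_def[abs_def] using base_pos
    by (intro continuous_on_powr continuous_on_const) (auto simp: less_imp_neq[symmetric])
qed

lemma profile_0: "profile \<alpha> M \<kappa> 0 = \<kappa> powr (1 / \<alpha>)"
  using \<kappa> by (simp add: profile_def powr_minus_divide powr_divide)

lemma profile_mass_eq: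
  "profile_mass \<alpha> M \<kappa> y = \<kappa> * y *
    ((\<kappa> * y / M) powr (\<alpha> / (1 - \<alpha>)) + 1 / \<kappa>) powr (- ((1 - \<alpha>) / \<alpha>))"
  unfolding profile_mass_def profile_def by (simp add: powr_powr)

lemma profile_mass_cont: "continuous_on {0..} (profile_mass \<alpha> M \<kappa>)"
  unfolding profile_mass_def[abs_def] using profile_pos
  by (intro continuous_on_mult continuous_on_powr continuous_on_const continuous_on_id profile_cont)
    (auto simp: less_imp_neq[symmetric])

text \<open>With S the base and c, q the exponents, c q = -1 reduces the product rule to \<kappa>
  S^c - \<kappa> S^(c-1) (S - 1/\<kappa>) = S^(c-1), and c - 1 = -1/\<alpha> is the exponent of
  \<open>profile\<close>.\<close>

lemma profile_mass_deriv:
  assumes y: "y > 0"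
  shows "(profile_mass \<alpha> M \<kappa> has_real_derivative profile \<alpha> M \<kappa> y) (at y)"
proof -
  define q c where "q = \<alpha> / (1 - \<alpha>)" and "c = - ((1 - \<alpha>) / \<alpha>)"
  define S where "S y = (\<kappa> * y / M) powr q + 1 / \<kappa>" for y
  have cq: "c * q = - 1" "c - 1 = - 1 / \<alpha>"
    using \<alpha> by (simp_all add: c_def q_def field_simps)
  have S: "S y > 0" for y
    unfolding S_def q_def by (rule base_pos)
  have z: "\<kappa> * y / M > 0"
    using y \<kappa> M by simp
  have dS: "(S has_real_derivative q * (\<kappa> * y / M) powr (q - 1) * (\<kappa> / M)) (at y)"
    unfolding S_def[abs_def] using z M
    by (auto intro!: derivative_eq_intros simp: powr_diff field_simps)
  have "((\<lambda>y. \<kappa> * y * S y powr c) has_real_derivative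
      \<kappa> * S y powr c + \<kappa> * y * (c * S y powr (c - 1) * (q * (\<kappa> * y / M) powr (q - 1) * (\<kappa> / M)))) (at y)"
    using S[of y] by (auto intro!: derivative_eq_intros dS simp: powr_diff field_simps)
  moreover have "\<kappa> * S y powr c + \<kappa> * y * (c * S y powr (c - 1) * (q * (\<kappa> * y / M) powr (q - 1) * (\<kappa> / M)))
      = \<kappa> * (S y powr (c - 1) * S y) + \<kappa> * (c * q) * S y powr (c - 1) * ((\<kappa> * y / M) powr (q - 1) * (\<kappa> * y / M))"
    using S[of y] by (simp add: powr_diff field_simps)
  also have "(\<kappa> * y / M) powr (q - 1) * (\<kappa> * y / M) = S y - 1 / \<kappa>"
    using powr_mult_base[of "\<kappa> * y / M" "q - 1"] z by (simp add: S_def mult.commute)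
  also have "\<kappa> * (S y powr (c - 1) * S y) + \<kappa> * (c * q) * S y powr (c - 1) * (S y - 1 / \<kappa>) = S y powr (c - 1)"
    using \<kappa> unfolding cq(1) by (simp add: field_simps)
  finally show ?thesis
    unfolding cq(2) unfolding profile_mass_eq[abs_def] profile_def S_def q_def c_def by simp
qed

text \<open>The integrated form of the separable equation: with q = \<alpha>/(1-\<alpha>), m^(-q)
  exceeds M^(-q) by a constant multiple of y^(-q). It shows the limit M and is what
  \<open>profile_unique\<close> arrives at.\<close>

lemma profile_mass_alt:
  assumes y: "y > 0"
  shows "profile_mass \<alpha> M \<kappa> y =
    (M powr (- \<alpha> / (1 - \<alpha>)) + \<kappa> powr (- 1 / (1 - \<alpha>)) * y powr (- \<alpha> / (1 - \<alpha>))) powr (- ((1 - \<alpha>) / \<alpha>))"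
proof -
  define q where "q = \<alpha> / (1 - \<alpha>)"
  have q: "q > 0" "- ((1 - \<alpha>) / \<alpha>) = - 1 / q" "- \<alpha> / (1 - \<alpha>) = - q" "- 1 / (1 - \<alpha>) = - q - 1"
    using \<alpha> by (simp_all add: q_def field_simps)
  have "(M powr (- q) + \<kappa> powr (- q - 1) * y powr (- q)) =
      (\<kappa> * y) powr (- q) * ((\<kappa> * y / M) powr q + 1 / \<kappa>)"
    using y \<kappa> M by (simp add: powr_mult powr_divide powr_minus powr_diff field_simps)
  moreover have "((\<kappa> * y) powr (- q)) powr (- 1 / q) = \<kappa> * y"
    using q(1) y \<kappa> by (simp add: powr_powr)
  ultimately show ?thesis
    unfolding profile_mass_eq q(2,3,4) unfolding q_def[symmetric]
    using y \<kappa> base_pos[of y] by (simp add: powr_mult q_def less_imp_le)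
qed

lemma profile_mass_tendsto: "(profile_mass \<alpha> M \<kappa> \<longlongrightarrow> M) at_top"
proof -
  have "((\<lambda>y::real. y powr (- \<alpha> / (1 - \<alpha>))) \<longlongrightarrow> 0) at_top"
    using \<alpha> by (intro tendsto_neg_powr filterlim_ident) (auto simp: divide_neg_pos)
  then have lim: "((\<lambda>y. (M powr (- \<alpha> / (1 - \<alpha>)) + \<kappa> powr (- 1 / (1 - \<alpha>)) * y powr (- \<alpha> / (1 - \<alpha>)))
        powr (- ((1 - \<alpha>) / \<alpha>)))
      \<longlongrightarrow> (M powr (- \<alpha> / (1 - \<alpha>)) + \<kappa> powr (- 1 / (1 - \<alpha>)) * 0) powr (- ((1 - \<alpha>) / \<alpha>))) at_top"
    using M by (intro tendsto_intros) auto
  have M_eq: "(M powr (- \<alpha> / (1 - \<alpha>)) + \<kappa> powr (- 1 / (1 - \<alpha>)) * 0) powr (- ((1 - \<alpha>) / \<alpha>)) = M"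
    using M \<alpha> by (simp add: powr_powr)
  have "\<forall>\<^sub>F y in at_top.
      (M powr (- \<alpha> / (1 - \<alpha>)) + \<kappa> powr (- 1 / (1 - \<alpha>)) * y powr (- \<alpha> / (1 - \<alpha>))) powr (- ((1 - \<alpha>) / \<alpha>))
      = profile_mass \<alpha> M \<kappa> y"
    using eventually_gt_at_top[of "0::real"] by eventually_elim (rule profile_mass_alt[symmetric])
  with lim[unfolded M_eq] show ?thesis
    by (rule Lim_transform_eventually)
qed

lemma profile_mass_pos: "y > 0 \<Longrightarrow> profile_mass \<alpha> M \<kappa> y > 0"
  using \<kappa> profile_pos[of y] by (simp add: profile_mass_def)

end

section \<open>Uniqueness for the degenerate radial equation\<close>

context radial_density
begin

lemma m_vanishes_if_f_vanishes:
  assumes "r0 \<ge> 0" "m r0 = 0" and f: "\<And>r. r > r0 \<Longrightarrow> f r = 0" and "r > r0"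
  shows "m r = 0"
proof -
  have "m r = m r0"
  proof (rule DERIV_isconst_end[OF \<open>r > r0\<close>])
    show "continuous_on {r0..r} m"
      using assms by (intro continuous_on_subset[OF m_cont]) auto
    show "(m has_real_derivative 0) (at x)" if "r0 < x" "x < r" for x
      using m_deriv[of x] f[OF that(1)] assms(1) that by simp
  qed
  then show ?thesis using assms(2) by simp
qed

text \<open>Beyond the last zero \<open>r0\<close> of m, the relation leaves the alternatives f = 0
  and m = \<kappa> y f^(1-\<alpha>). Continuity selects the second throughout, the separable
  equation is then integrated inward from infinity, and the resulting formula forces
  \<open>r0 = 0\<close>.\<close>

lemma profile_unique:
  assumes \<alpha>: "0 < \<alpha>" "\<alpha> < 1" and M: "M > 0" and lim: "(m \<longlongrightarrow> M) at_top"
    and eq: "\<And>r. r > 0 \<Longrightarrow> f r powr \<alpha> * m r = \<kappa> * (\<omega> * r ^ DIM('a)) * f r"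
  shows "\<kappa> > 0 \<and> (\<forall>r\<ge>0. f r = profile \<alpha> M \<kappa> (\<omega> * r ^ DIM('a)))"
proof -
  define y where "y r = \<omega> * r ^ DIM('a)" for r
  have y_pos: "y r > 0" if "r > 0" for r
    using that omega_pos by (simp add: y_def)
  obtain R where R: "R \<ge> 0" "m R > 0"
    using eventually_conj[OF order_tendstoD(1)[OF lim M] eventually_ge_at_top[of 0]]
    by (auto simp: eventually_at_top_linorder)
  \<comment> \<open>The zeros of m up to a radius where m is positive form a compact set containing
    0; its largest element is the edge of the region free of mass.\<close>
  define K where "K = {r \<in> {0..R}. m r = 0}"
  have "closed K"
    unfolding K_def
    by (intro continuous_closed_preimage_constant continuous_on_subset[OF m_cont]) auto
  then have "compact K"
    using compact_Int_closed[of "{0..R}" K] by (simp add: K_def Int_absorb1 subset_iff inf.absorb2)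
  moreover have "0 \<in> K"
    using m_0 R by (simp add: K_def)
  ultimately obtain r0 where r0: "r0 \<in> K" "\<And>r. r \<in> K \<Longrightarrow> r \<le> r0"
    using compact_attains_sup[of K] by auto
  have r0_nonneg: "r0 \<ge> 0" and m_r0: "m r0 = 0"
    using r0(1) by (auto simp: K_def)
  have m_pos: "m r > 0" if "r > r0" for r
  proof (cases "r \<le> R")
    case True
    then have "m r \<noteq> 0"
      using r0(2)[of r] that r0_nonneg by (auto simp: K_def)
    then show ?thesis
      using m_nonneg[of r] that r0_nonneg by simp
  next
    case False
    then show ?thesis
      using m_mono[of R r] R by simp
  qed
  have not_vanish: False if "\<And>r. r > r0 \<Longrightarrow> f r = 0"
    using m_vanishes_if_f_vanishes[OF r0_nonneg m_r0 that, of "r0 + 1"] m_pos[of "r0 + 1"] by simp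
  have \<kappa>: "\<kappa> > 0"
  \<comment> \<open>For \<kappa> \<le> 0 the two sides of the relation have opposite signs, so f
    would vanish beyond \<open>r0\<close>, although m must still grow there.\<close>
  proof (rule ccontr)
    assume "\<not> \<kappa> > 0"
    have "f r = 0" if r: "r > r0" for r
    proof -
      have "\<kappa> * y r * f r \<le> 0"
        using \<open>\<not> \<kappa> > 0\<close> y_pos[of r] f_nonneg[of r] r r0_nonneg
        by (simp add: mult_nonpos_nonneg mult_nonneg_nonneg)
      then have "f r powr \<alpha> * m r \<le> 0"
        using eq[of r] r r0_nonneg by (simp add: y_def)
      then show ?thesis
        using m_pos[OF r] by (simp add: mult_le_0_iff)
    qed
    then show False by (rule not_vanish)
  qed
  interpret profile_parameters \<alpha> M \<kappa>
    using \<alpha> M \<kappa> by unfold_locales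
  have alt: "f r = 0 \<or> m r = \<kappa> * y r * f r powr (1 - \<alpha>)" if r: "r > r0" for r
  proof (cases "f r = 0")
    case False
    then have "f r powr \<alpha> > 0"
      by simp
    moreover have "f r powr \<alpha> * m r = f r powr \<alpha> * (\<kappa> * y r * f r powr (1 - \<alpha>))"
      using eq[of r] False f_nonneg[of r] r r0_nonneg by (simp add: y_def powr_diff)
    ultimately show ?thesis by simp
  qed simp
  have m_eq: "m r = \<kappa> * y r * f r powr (1 - \<alpha>)" if r: "r > r0" for r
  proof -
    \<comment> \<open>A continuous function on a connected set with values in {0, 1} is constant,
      and the constant 0 would make f vanish beyond \<open>r0\<close>.\<close>
    define h where "h r = \<kappa> * y r * f r powr (1 - \<alpha>) / m r" for r
    have range: "h r = 0 \<or> h r = 1" if "r > r0" for r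
      using alt[OF that] m_pos[OF that] by (auto simp: h_def)
    have f_cont': "continuous_on {r0<..} f" and m_cont': "continuous_on {r0<..} m"
      using r0_nonneg by (auto intro: continuous_on_subset[OF f_cont] continuous_on_subset[OF m_cont])
    have "continuous_on {r0<..} h"
      unfolding h_def[abs_def] y_def using \<alpha> r0_nonneg f_nonneg m_pos
      by (intro continuous_on_powr' continuous_intros f_cont' m_cont') (auto simp: less_imp_neq[symmetric])
    moreover have "finite (h ` {r0<..})"
      by (rule finite_subset[of _ "{0, 1}"]) (use range in auto)
    ultimately have "h constant_on {r0<..}"
      by (intro continuous_finite_range_constant) auto
    then obtain c where c: "\<And>r. r > r0 \<Longrightarrow> h r = c"
      by (auto simp: constant_on_def)
    have "c \<noteq> 0"
    proof
      assume "c = 0"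
      have "f s = 0" if "s > r0" for s
        using c[OF that] \<open>c = 0\<close> m_pos[OF that] y_pos[of s] \<kappa> r0_nonneg that by (auto simp: h_def)
      then show False by (rule not_vanish)
    qed
    then have "h r = 1"
      using c[OF r] range[OF r] by simp
    then show ?thesis
      using m_pos[OF r] by (simp add: h_def)
  qed
  define p q where "p = 1 / (1 - \<alpha>)" and "q = \<alpha> / (1 - \<alpha>)"
  have pq: "q > 0" "p = q + 1" "(1 - \<alpha>) * p = 1"
    using \<alpha> by (simp_all add: p_def q_def field_simps)
  have f_eq: "f r = (m r / (\<kappa> * y r)) powr p" if r: "r > r0" for r
    using m_eq[OF r] y_pos[of r] \<kappa> r r0_nonneg f_nonneg[of r] pq(3) by (simp add: powr_powr)
  \<comment> \<open>A first integral of dm/dy = (m / (\<kappa> y))^p, obtained by separating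
    variables. Its value is read off at infinity, where m tends to M and the second term
    vanishes.\<close>
  define \<Phi> where "\<Phi> r = m r powr (- q) - \<kappa> powr (- p) * y r powr (- q)" for r
  have \<Phi>_deriv: "(\<Phi> has_real_derivative 0) (at r)" if r: "r > r0" for r
  proof -
    define y' where "y' = DIM('a) * \<omega> * r ^ (DIM('a) - 1)"
    have pos: "m r > 0" "y r > 0"
      using m_pos[OF r] y_pos[of r] r r0_nonneg by auto
    have dy: "(y has_real_derivative y') (at r)"
      unfolding y_def[abs_def] y'_def by (auto intro!: derivative_eq_intros)
    have dm: "(m has_real_derivative y' * f r) (at r)"
      using m_deriv[of r] r r0_nonneg by (simp add: y'_def)
    have "(\<Phi> has_real_derivative - q * m r powr (- q - 1) * (y' * f r) -
        \<kappa> powr (- p) * (- q * y r powr (- q - 1) * y')) (at r)"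
      unfolding \<Phi>_def[abs_def] using pos
      by (auto intro!: derivative_eq_intros dy dm simp: powr_diff field_simps)
    moreover have "m r powr (- q - 1) * f r = \<kappa> powr (- p) * y r powr (- q - 1)"
    proof -
      have exponent: "- q - 1 = - p"
        using pq(2) by simp
      show ?thesis
        unfolding f_eq[OF r] exponent using pos \<kappa> by (simp add: powr_divide powr_mult powr_minus field_simps)
    qed
    then have "- q * y' * (m r powr (- q - 1) * f r - \<kappa> powr (- p) * y r powr (- q - 1)) = 0"
      by simp
    then have "- q * m r powr (- q - 1) * (y' * f r) - \<kappa> powr (- p) * (- q * y r powr (- q - 1) * y') = 0"
      by (simp only: algebra_simps)
    ultimately show ?thesis
      using DERIV_cong by blast
  qed
  have "\<Phi> r = M powr (- q)" if r: "r > r0" for r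
  proof -
    have const: "\<Phi> s = \<Phi> r" if "s > r0" for s
      by (rule DERIV_isconst3[of r0 "max r s + 1"]) (use r that \<Phi>_deriv in auto)
    have y_top: "filterlim y at_top at_top"
      unfolding y_def[abs_def] using omega_pos
      by (intro filterlim_tendsto_pos_mult_at_top[OF tendsto_const] filterlim_pow_at_top filterlim_ident) auto
    have "(\<Phi> \<longlongrightarrow> M powr (- q) - \<kappa> powr (- p) * 0) at_top"
      unfolding \<Phi>_def[abs_def] using M pq(1)
      by (intro tendsto_intros lim tendsto_neg_powr y_top) auto
    moreover have "\<forall>\<^sub>F s in at_top. \<Phi> s = \<Phi> r"
      using eventually_gt_at_top[of r0] by eventually_elim (rule const)
    then have "(\<Phi> \<longlongrightarrow> \<Phi> r) at_top"
      by (rule tendsto_eventually)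
    ultimately show ?thesis
      using tendsto_unique trivial_limit_at_top_linorder by fastforce
  qed
  then have m_profile: "m r = profile_mass \<alpha> M \<kappa> (y r)" if r: "r > r0" for r
  proof -
    have "m r powr (- q) = M powr (- q) + \<kappa> powr (- p) * y r powr (- q)"
      using \<open>\<And>r. r > r0 \<Longrightarrow> \<Phi> r = M powr (- q)\<close>[OF r] by (simp add: \<Phi>_def)
    then have "(M powr (- q) + \<kappa> powr (- p) * y r powr (- q)) powr (- (1 / q)) = m r"
      using m_pos[OF r] pq(1) by (simp add: powr_powr flip: \<open>m r powr (- q) = _\<close>)
    moreover have "- \<alpha> / (1 - \<alpha>) = - q" "- 1 / (1 - \<alpha>) = - p" "(1 - \<alpha>) / \<alpha> = 1 / q"
      using \<alpha> by (simp_all add: p_def q_def)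
    ultimately show ?thesis
      using profile_mass_alt[OF y_pos, of r] r r0_nonneg by simp
  qed
  \<comment> \<open>At a positive \<open>r0\<close> the mass vanishes, whereas by continuity from
    the right it equals the strictly positive profile mass.\<close>
  have "r0 = 0"
  proof (rule ccontr)
    assume "r0 \<noteq> 0"
    then have r0_pos: "r0 > 0"
      using r0_nonneg by simp
    have "isCont m r0"
      by (rule DERIV_isCont[OF m_deriv[OF r0_pos]])
    then have "(m \<longlongrightarrow> 0) (at_right r0)"
      unfolding isCont_def m_r0 by (rule tendsto_within_subset) auto
    moreover have "isCont (\<lambda>r. profile_mass \<alpha> M \<kappa> (y r)) r0"
      by (rule isCont_o2[where g = "profile_mass \<alpha> M \<kappa>"])
        (auto simp: y_def[abs_def] intro!: DERIV_isCont[OF profile_mass_deriv] y_pos[unfolded y_def] r0_pos)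
    then have "((\<lambda>r. profile_mass \<alpha> M \<kappa> (y r)) \<longlongrightarrow> profile_mass \<alpha> M \<kappa> (y r0)) (at_right r0)"
      unfolding isCont_def by (rule tendsto_within_subset) auto
    then have "(m \<longlongrightarrow> profile_mass \<alpha> M \<kappa> (y r0)) (at_right r0)"
      by (rule Lim_transform_eventually) (use m_profile in \<open>auto simp: eventually_at_filter\<close>)
    ultimately have "profile_mass \<alpha> M \<kappa> (y r0) = 0"
      using tendsto_unique trivial_limit_at_right_real by blast
    then show False
      using profile_mass_pos[OF y_pos[OF r0_pos]] by simp
  qed
  have f_profile: "f r = profile \<alpha> M \<kappa> (y r)" if r: "r > 0" for r
  proof -
    have "m r / (\<kappa> * y r) = profile \<alpha> M \<kappa> (y r) powr (1 - \<alpha>)"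
      using m_profile[of r] r \<open>r0 = 0\<close> y_pos[OF r] \<kappa> by (simp add: profile_mass_def)
    then show ?thesis
      using f_eq[of r] r \<open>r0 = 0\<close> pq(3) profile_pos[of "y r"] by (simp add: powr_powr)
  qed
  moreover have "f 0 = profile \<alpha> M \<kappa> (y 0)"
  proof -
    have "continuous_on {0..} (\<lambda>r. profile \<alpha> M \<kappa> (y r))"
      unfolding y_def using omega_pos
      by (intro continuous_on_compose2[OF profile_cont] continuous_intros) auto
    then have "((\<lambda>r. profile \<alpha> M \<kappa> (y r)) \<longlongrightarrow> profile \<alpha> M \<kappa> (y 0)) (at 0 within {0..})"
      unfolding continuous_on_def by simp
    then have "((\<lambda>r. profile \<alpha> M \<kappa> (y r)) \<longlongrightarrow> profile \<alpha> M \<kappa> (y 0)) (at_right 0)"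
      by (rule tendsto_within_subset) auto
    then have "(f \<longlongrightarrow> profile \<alpha> M \<kappa> (y 0)) (at_right 0)"
      by (rule Lim_transform_eventually) (use f_profile in \<open>auto simp: eventually_at_filter\<close>)
    moreover have "(f \<longlongrightarrow> f 0) (at 0 within {0..})"
      using f_cont unfolding continuous_on_def by simp
    then have "(f \<longlongrightarrow> f 0) (at_right 0)"
      by (rule tendsto_within_subset) auto
    ultimately show ?thesis
      using tendsto_unique trivial_limit_at_right_real by blast
  qed
  ultimately have "f r = profile \<alpha> M \<kappa> (y r)" if "r \<ge> 0" for r
    using that by (cases "r = 0") auto
  then show ?thesis
    using \<kappa> by (simp add: y_def)
qed

end

section \<open>Self-similar solutions have the profile\<close>

lemma lborel_integral_scaleR:
  fixes g :: "'a::euclidean_space \<Rightarrow> real"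
  assumes [measurable]: "g \<in> borel_measurable borel" and c: "c > 0"
  shows "(LINT x|lborel. g x) = c ^ DIM('a) * (LINT x|lborel. g (c *\<^sub>R x))"
proof -
  have "(LINT x|lborel. g x) = (LINT x|density (distr lborel borel (\<lambda>x. 0 + c *\<^sub>R x)) (\<lambda>_. \<bar>c\<bar> ^ DIM('a)). g x)"
    using lborel_affine[of c "0::'a"] c by simp
  also have "\<dots> = (LINT x|distr lborel borel (\<lambda>x::'a. 0 + c *\<^sub>R x). \<bar>c\<bar> ^ DIM('a) *\<^sub>R g x)"
    by (rule integral_density) auto
  also have "\<dots> = (LINT x|lborel. \<bar>c\<bar> ^ DIM('a) *\<^sub>R g (0 + c *\<^sub>R x))"
    by (rule integral_distr) auto
  finally show ?thesis
    using c by simp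
qed

lemma integral_scaled_point_mass:
  fixes \<phi> :: "'a::euclidean_space \<Rightarrow> real"
  assumes [measurable]: "\<phi> \<in> borel_measurable borel" and "M \<ge> 0"
  shows "(LINT x|scale_measure (ennreal M) (return borel a). \<phi> x) = M * \<phi> a"
proof -
  let ?N = "scale_measure (ennreal M) (return borel a) :: 'a measure"
  have "AE x in ?N. x = a"
    by (rule AE_I[of _ _ "- {a}"]) (auto simp: space_scale_measure)
  moreover have "\<phi> \<in> borel_measurable ?N"
    using assms(1) by (subst measurable_cong_sets[of ?N borel borel borel]) auto
  ultimately have "(LINT x|?N. \<phi> x) = (LINT x|?N. \<phi> a)"
    by (intro integral_cong_AE) auto
  also have "measure ?N (space ?N) = M"
    using \<open>M \<ge> 0\<close> by (simp add: space_scale_measure measure_return)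
  then have "(LINT x|?N. \<phi> a) = M * \<phi> a"
    by simp
  finally show ?thesis .
qed

text \<open>Moving \<open>\<rho>\<close> at a fixed time is the same as moving the time at fixed \<open>r\<close>: by self-similarity
  \<open>\<rho>\<^sup>n u(t, \<rho>) = r\<^sup>n u(s, r)\<close> for \<open>s = t (r/\<rho>)\<^bsup>1/\<beta>\<^esup>\<close>. This yields differentiability in space.\<close>

lemma self_similar_conservation_form:
  fixes F :: "real \<Rightarrow> real" and n :: nat and \<beta> :: real
  defines "w \<equiv> (\<lambda>s r. s powr (- (n * \<beta>)) * F (r * s powr (- \<beta>)))"
  assumes t: "t > 0" and r: "r > 0" and n: "n > 0"
    and D: "((\<lambda>s. w s r) has_real_derivative D) (at t)"
  shows "((\<lambda>\<rho>. \<beta> / t * (\<rho> ^ n * w t \<rho>)) has_real_derivative - (r ^ (n - 1) * D)) (at r)"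
\<comment> \<open>The substitution for s needs 1/\<beta>. For \<beta> = 0 the function w does not
  depend on time, so both sides are zero.\<close>
proof (cases "\<beta> = 0")
  case True
  have "((\<lambda>s. w s r) has_real_derivative 0) (at t)"
    by (rule has_field_derivative_transform_within_open[of "\<lambda>s. F r" _ _ "{0<..}"])
      (use t True in \<open>auto simp: w_def\<close>)
  then have "D = 0"
    using D DERIV_unique by blast
  then show ?thesis
    using True by simp
next
  case False
  define s where "s \<rho> = t * (r / \<rho>) powr (1 / \<beta>)" for \<rho>
  have s_r: "s r = t"
    using r by (simp add: s_def)
  have ds: "(s has_real_derivative - (t / (\<beta> * r))) (at r)"
    unfolding s_def[abs_def] using r False t
    by (auto intro!: derivative_eq_intros simp: field_simps power2_eq_square)
  have "((\<lambda>\<rho>. w (s \<rho>) r) has_real_derivative D * - (t / (\<beta> * r))) (at r)"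
    by (rule DERIV_chain2[OF _ ds]) (use D s_r in simp)
  then have "((\<lambda>\<rho>. \<beta> / t * (r ^ n * w (s \<rho>) r)) has_real_derivative
      \<beta> / t * (r ^ n * (D * - (t / (\<beta> * r))))) (at r)"
    by (intro DERIV_cmult)
  moreover have "\<beta> / t * (r ^ n * (D * - (t / (\<beta> * r)))) = - (r ^ (n - 1) * D)"
    using t False r n by (simp add: field_simps flip: power_Suc)
  moreover have "\<beta> / t * (r ^ n * w (s \<rho>) r) = \<beta> / t * (\<rho> ^ n * w t \<rho>)" if \<rho>: "\<rho> > 0" for \<rho>
  proof -
    have "s \<rho> powr (- \<beta>) = t powr (- \<beta>) * (\<rho> / r)"
      using t r \<rho> False by (simp add: s_def powr_mult powr_powr powr_minus powr_one field_simps)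
    moreover have "s \<rho> powr (- (n * \<beta>)) = t powr (- (n * \<beta>)) * (\<rho> / r) ^ n"
      using t r \<rho> False
      by (simp add: s_def powr_mult powr_powr powr_minus powr_realpow power_divide field_simps)
    ultimately show ?thesis
      using r by (simp add: w_def power_divide mult.commute)
  qed
  ultimately show ?thesis
    using has_field_derivative_transform_within_open[of _ _ r "{0<..}"] r by fastforce
qed

context radial_density
begin

text \<open>For a radial flux B(r) x, r^(n-1) times the divergence is the derivative of r^n B, and
  by \<open>self_similar_conservation_form\<close> r^(n-1) times the time derivative is minus that
  of (\<beta>/t) r^n f. The equation thus says that the sum of the two quantities is constant, and
  it is 0 at the origin.\<close>

lemma flux_identity:
  fixes F :: "real \<Rightarrow> real" and \<beta> :: real
  assumes \<alpha>: "\<alpha> > 0" and t: "t > 0"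
    and f_def: "\<And>r. r \<ge> 0 \<Longrightarrow> f r = t powr (- (DIM('a) * \<beta>)) * F (r * t powr (- \<beta>))"
    and eq: "\<And>x. \<exists>D. has_divergence (\<lambda>y. (u y powr \<alpha>) *\<^sub>R field y) D x \<and>
      ((\<lambda>s. s powr (- (DIM('a) * \<beta>)) * F (norm x * s powr (- \<beta>))) has_real_derivative D) (at t)"
    and r: "r > 0"
  shows "f r powr \<alpha> * m r = DIM('a) * \<beta> / t * (\<omega> * r ^ DIM('a)) * f r"
proof -
  let ?n = "DIM('a)"
  define w where "w = (\<lambda>s r. s powr (- (?n * \<beta>)) * F (r * s powr (- \<beta>)))"
  define B where "B r = - (f r powr \<alpha> * A r)" for r
  \<comment> \<open>Written with m instead of A, so that continuity up to r = 0 is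
    immediate.\<close>
  define H where "H r = \<beta> / t * (r ^ ?n * f r) - f r powr \<alpha> * m r / (?n * \<omega>)" for r
  have H_eq: "H r = \<beta> / t * (r ^ ?n * f r) + r ^ ?n * B r" if "r > 0" for r
    using that omega_pos by (simp add: H_def B_def A_def)
  have "(H has_real_derivative 0) (at r)" if r: "r > 0" for r
  proof -
    obtain e :: 'a where "e \<in> Basis"
      using nonempty_Basis by blast
    then have x: "norm (r *\<^sub>R e) = r"
      using r by simp
    obtain D where D: "has_divergence (\<lambda>y. (u y powr \<alpha>) *\<^sub>R field y) D (r *\<^sub>R e)"
      "((\<lambda>s. w s r) has_real_derivative D) (at t)"
      using eq[of "r *\<^sub>R e"] unfolding x w_def by blast
    have "(\<lambda>y. (u y powr \<alpha>) *\<^sub>R field y) = (\<lambda>y. B (norm y) *\<^sub>R y)"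
      by (simp add: B_def field_def u)
    with D(1) have "has_divergence (\<lambda>y. B (norm y) *\<^sub>R y) D (r *\<^sub>R e)"
      by simp
    then obtain B' where B': "(B has_real_derivative B') (at r)" "D = ?n * B r + r * B'"
      using radial_has_real_derivative[of "r *\<^sub>R e" B D] x r by metis
    have "((\<lambda>r. r ^ ?n * B r) has_real_derivative ?n * r ^ (?n - 1) * B r + r ^ ?n * B') (at r)"
      by (auto intro!: derivative_eq_intros B')
    moreover have "?n * r ^ (?n - 1) * B r + r ^ ?n * B' = r ^ (?n - 1) * D"
      unfolding B'(2) r_power_DIM by (simp add: algebra_simps)
    moreover have "((\<lambda>\<rho>. \<beta> / t * (\<rho> ^ ?n * w t \<rho>)) has_real_derivative - (r ^ (?n - 1) * D)) (at r)"
      using self_similar_conservation_form[OF t r DIM_positive[where 'a = 'a] D(2)[unfolded w_def]]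
      by (simp add: w_def)
    ultimately have "((\<lambda>\<rho>. \<beta> / t * (\<rho> ^ ?n * w t \<rho>) + \<rho> ^ ?n * B \<rho>) has_real_derivative
        - (r ^ (?n - 1) * D) + r ^ (?n - 1) * D) (at r)"
      by (intro DERIV_add) auto
    then have "((\<lambda>\<rho>. \<beta> / t * (\<rho> ^ ?n * w t \<rho>) + \<rho> ^ ?n * B \<rho>) has_real_derivative 0) (at r)"
      by simp
    then show ?thesis
      by (rule has_field_derivative_transform_within_open[where S = "{0<..}"])
        (use r H_eq f_def in \<open>auto simp: w_def\<close>)
  qed
  moreover have "continuous_on {0..} H"
  proof -
    have "continuous_on {0..} (\<lambda>r. f r powr \<alpha>)"
      using \<alpha> f_nonneg by (intro continuous_on_powr' f_cont continuous_on_const) auto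
    then show ?thesis
      unfolding H_def[abs_def] using omega_pos
      by (intro continuous_on_diff continuous_on_mult continuous_on_divide continuous_on_power
          continuous_on_const continuous_on_id f_cont m_cont) auto
  qed
  ultimately have "H r = H 0"
    using r by (intro DERIV_isconst_end) (auto intro: continuous_on_subset)
  also have "H 0 = 0"
    by (simp add: H_def m_0 zero_power)
  finally show ?thesis
    using omega_pos t by (simp add: H_def field_simps)
qed

end

text \<open>Here 1/\<kappa> = \<alpha> t, and t is factored out of the base. The powers of t agree
  because q/\<alpha> = 1 + q for q = \<alpha>/(1-\<alpha>).\<close>

lemma profile_formula:
  assumes "0 < \<alpha>" "\<alpha> < 1" "M > 0" "t > 0" "y \<ge> 0"
  shows "profile \<alpha> M (1 / (\<alpha> * t)) y =
    t powr (- 1 / \<alpha>) * (\<alpha> + (y * t powr (- 1 / \<alpha>) / (\<alpha> * M)) powr (\<alpha> / (1 - \<alpha>))) powr (- 1 / \<alpha>)"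
proof -
  define q where "q = \<alpha> / (1 - \<alpha>)"
  have q: "- 1 / \<alpha> * q = - 1 - q"
    using assms by (simp add: q_def field_simps)
  have "(1 / (\<alpha> * t) * y / M) powr q + 1 / (1 / (\<alpha> * t)) =
      t * (\<alpha> + (y / (\<alpha> * M)) powr q * t powr (- 1 - q))"
    using assms by (simp add: powr_divide powr_mult powr_diff powr_minus field_simps)
  also have "(y / (\<alpha> * M)) powr q * t powr (- 1 - q) = (y * t powr (- 1 / \<alpha>) / (\<alpha> * M)) powr q"
    using assms by (simp only: powr_powr q powr_mult powr_divide)
      (simp add: powr_powr powr_mult powr_divide flip: q)
  finally have "profile \<alpha> M (1 / (\<alpha> * t)) y =
      (t * (\<alpha> + (y * t powr (- 1 / \<alpha>) / (\<alpha> * M)) powr q)) powr (- 1 / \<alpha>)"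
    by (simp add: profile_def q_def)
  then show ?thesis
    using assms by (simp add: powr_mult q_def)
qed

text \<open>The slices at times 1 and 2 are rescalings of each other; equality of their nonzero
  masses gives 2^(-\<gamma>) = 2^(-d\<beta>).\<close>

lemma self_similar_mass_exponent:
  fixes u :: "real \<Rightarrow> 'a::euclidean_space \<Rightarrow> real" and \<beta> \<gamma> :: real
  assumes ss: "\<And>t x. t > 0 \<Longrightarrow> u t x = t powr (- \<gamma>) * F (norm x * t powr (- \<beta>))"
    and meas: "u 1 \<in> borel_measurable borel"
    and mass: "\<And>t. t > 0 \<Longrightarrow> (LINT x|lborel. u t x) = M" and M: "M \<noteq> 0"
  shows "\<gamma> = DIM('a) * \<beta>"
proof -
  define c :: real where "c = 2 powr (- \<beta>)"
  have c: "c > 0"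
    by (simp add: c_def)
  have "u 2 x = 2 powr (- \<gamma>) * u 1 (c *\<^sub>R x)" for x
    using ss[of 2 x] ss[of 1 "c *\<^sub>R x"] c by (simp add: c_def mult.commute)
  then have "M = 2 powr (- \<gamma>) * (LINT x|lborel. u 1 (c *\<^sub>R x))"
    using mass[of 2] by simp
  moreover have "M = c ^ DIM('a) * (LINT x|lborel. u 1 (c *\<^sub>R x))"
    using lborel_integral_scaleR[OF meas c] mass[of 1] by simp
  ultimately have "2 powr (- \<gamma>) = c ^ DIM('a)"
    using M by (metis mult_cancel_right mult_zero_right)
  also have "\<dots> = 2 powr (- (DIM('a) * \<beta>))"
    by (simp add: c_def powr_realpow[symmetric] powr_powr mult.commute)
  finally show ?thesis
    by (simp add: powr_inj)
qed

lemma self_similar_solution_imp_profile: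
  fixes u :: "real \<Rightarrow> 'a::euclidean_space \<Rightarrow> real"
  assumes \<alpha>: "0 < \<alpha>" "\<alpha> < 1" and M: "M > 0" and sol: "self_similar_solution \<alpha> M u" and t: "t > 0"
  shows "u t x = profile \<alpha> M (1 / (\<alpha> * t)) (measure lborel (ball (0::'a) 1) * norm x ^ DIM('a))"
proof -
  let ?n = "DIM('a)" and ?\<omega> = "measure lborel (ball (0::'a) 1)"
  obtain \<gamma> \<beta> F where ss: "\<And>t x. t > 0 \<Longrightarrow> u t x = t powr (- \<gamma>) * F (norm x * t powr (- \<beta>))"
    using sol unfolding self_similar_solution_def self_similar_def by blast
  have mass: "(LINT x|lborel. u t x) = M" if "t > 0" for t
    using sol that unfolding self_similar_solution_def by blast
  obtain v where "solves_problem \<alpha> (scale_measure (ennreal M) (return borel 0)) u v"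
    using sol unfolding self_similar_solution_def by blast
  note eqs = this[unfolded solves_problem_def]
  from eqs have cont: "continuous_on ({0<..} \<times> UNIV) (\<lambda>(t, x). u t x)"
    by (elim conjE)
  from eqs have "\<forall>t>0. (\<forall>x. u t x \<ge> 0) \<and> integrable lborel (u t)"
    by (elim conjE)
  then have u_nonneg: "u t x \<ge> 0" and int: "integrable lborel (u t)" if "t > 0" for t x
    using that by auto
  from eqs have "\<forall>t>0. (u t \<longlongrightarrow> 0) at_infinity \<and> potential_at_infinity (u t) (v t)"
    by (elim conjE)
  then have inf: "potential_at_infinity (u t) (v t)" if "t > 0" for t
    using that by auto
  from eqs obtain G where "\<forall>t>0. \<forall>x. GDERIV (v t) x :> G t x \<and> has_divergence (G t) (- u t x) x \<and>
        (\<exists>D. has_divergence (\<lambda>y. (u t y powr \<alpha>) *\<^sub>R G t y) D x \<and>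
             ((\<lambda>s. u s x) has_real_derivative D) (at t))"
    by (elim conjE exE)
  then have G: "GDERIV (v t) x :> G t x" "has_divergence (G t) (- u t x) x"
      "\<exists>D. has_divergence (\<lambda>y. (u t y powr \<alpha>) *\<^sub>R G t y) D x \<and>
             ((\<lambda>s. u s x) has_real_derivative D) (at t)" if "t > 0" for t x
    using that by auto
  have \<gamma>: "\<gamma> = ?n * \<beta>"
    by (rule self_similar_mass_exponent[OF ss _ mass]) (use int[of 1] M in auto)
  obtain e :: 'a where e: "norm e = 1"
    using nonempty_Basis norm_Basis by blast
  have slice: "?n * \<beta> / t > 0 \<and> u t x = profile \<alpha> M (?n * \<beta> / t) (?\<omega> * norm x ^ ?n)"
    if t: "t > 0" for t x
  proof -
    \<comment> \<open>By radial symmetry the restriction to the ray of a unit vector carries the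
      whole slice and inherits its continuity, which is not assumed of F.\<close>
    define f where "f r = u t (r *\<^sub>R e)" for r
    have f_eq: "f r = t powr (- (?n * \<beta>)) * F (r * t powr (- \<beta>))" if "r \<ge> 0" for r
      using that t e by (simp add: f_def ss \<gamma>)
    have u_f: "u t y = f (norm y)" for y
      using t e by (simp add: f_def ss)
    have "continuous_on UNIV (\<lambda>r. (\<lambda>(t, x). u t x) (t, r *\<^sub>R e))"
      by (rule continuous_on_compose2[OF cont]) (use t in \<open>auto intro!: continuous_intros\<close>)
    then have f_cont: "continuous_on {0..} f"
      unfolding f_def[abs_def] by (auto intro: continuous_on_subset)
    have "continuous_on {0..} (\<lambda>r. ?n * ?\<omega> * r ^ (?n - 1) * f r)"
      by (intro continuous_intros f_cont)
    then obtain m where m: "m 0 = 0"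
      "\<And>r. r \<ge> 0 \<Longrightarrow> (m has_real_derivative ?n * ?\<omega> * r ^ (?n - 1) * f r) (at r within {0..})"
      using half_line_antiderivative by blast
    interpret radial_density "u t" f m ?\<omega>
    proof unfold_locales
      show "continuous_on {0..} m"
        using m(2) by (intro DERIV_continuous_on) auto
      show "(m has_real_derivative ?n * ?\<omega> * r ^ (?n - 1) * f r) (at r)" if "r > 0" for r
        using half_line_derivative_at[OF that m(2)] that by simp
    qed (use u_f f_cont u_nonneg[OF t] m(1) in \<open>auto simp: f_def\<close>)
    obtain v' where "\<And>x. GDERIV v' x :> field x" "potential_at_infinity (u t) v'"
      using potential_exists[OF int[OF t]] by blast
    then have "G t = field"
      using potential_gradient_unique[OF G(1,2)[OF t] _ field_divergence inf[OF t]] by blast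
    then have eq: "\<exists>D. has_divergence (\<lambda>y. (u t y powr \<alpha>) *\<^sub>R field y) D x \<and>
      ((\<lambda>s. s powr (- (?n * \<beta>)) * F (norm x * s powr (- \<beta>))) has_real_derivative D) (at t)" for x
    proof -
      obtain D where D: "has_divergence (\<lambda>y. (u t y powr \<alpha>) *\<^sub>R G t y) D x"
        "((\<lambda>s. u s x) has_real_derivative D) (at t)"
        using G(3)[OF t] by blast
      have "((\<lambda>s. s powr (- (?n * \<beta>)) * F (norm x * s powr (- \<beta>))) has_real_derivative D) (at t)"
        by (rule has_field_derivative_transform_within_open[OF D(2), of "{0<..}"])
          (use t in \<open>auto simp: ss \<gamma>\<close>)
      with D(1) \<open>G t = field\<close> show ?thesis by auto
    qed
    have "(m \<longlongrightarrow> M) at_top"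
      using m_tendsto[OF int[OF t]] mass[OF t] by simp
    from profile_unique[OF \<alpha> M this flux_identity[OF \<alpha>(1) t f_eq eq]]
    show ?thesis
      by (simp add: u_f)
  qed
  have pos: "?n * \<beta> > 0"
    using slice[of 1] by simp
  have "u t 0 = (?n * \<beta> / t) powr (1 / \<alpha>)" if t: "t > 0" for t
  proof -
    interpret profile_parameters \<alpha> M "?n * \<beta> / t"
      using \<alpha> M slice[OF t] by unfold_locales auto
    show ?thesis
      using slice[OF t, of 0] profile_0 by (simp add: zero_power)
  qed
  \<comment> \<open>The profile gives u(t, 0) = (d\<beta>/t)^(1/\<alpha>). Its ratio between times 1
    and 2 is compared with the one dictated by self-similarity; positivity of d\<beta> allows the
    common factor to cancel.\<close>
  moreover have "u 2 0 = 2 powr (- (?n * \<beta>)) * u 1 0"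
    using ss[of 1 0] ss[of 2 0] \<gamma> by simp
  ultimately have "(?n * \<beta> / 2) powr (1 / \<alpha>) = 2 powr (- (?n * \<beta>)) * (?n * \<beta>) powr (1 / \<alpha>)"
    by simp
  then have "2 powr (- (1 / \<alpha>)) = 2 powr (- (?n * \<beta>))"
    using pos by (auto simp: powr_divide powr_minus field_simps)
  then have "?n * \<beta> = 1 / \<alpha>"
    by (simp add: powr_inj)
  then show ?thesis
    using slice[OF t, of x] by simp
qed

section \<open>The profile is a solution\<close>

text \<open>This is -y times the derivative of the profile, with the division by y carried out. It
  is therefore meaningful at y = 0, where it is 0, even though the profile may fail to be
  differentiable there.\<close>

definition profile_slope :: "real \<Rightarrow> real \<Rightarrow> real \<Rightarrow> real \<Rightarrow> real" where
  "profile_slope \<alpha> M \<kappa> y = 1 / (1 - \<alpha>) * (\<kappa> * y / M) powr (\<alpha> / (1 - \<alpha>)) *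
    ((\<kappa> * y / M) powr (\<alpha> / (1 - \<alpha>)) + 1 / \<kappa>) powr (- 1 / \<alpha> - 1)"

context profile_parameters
begin

lemma profile_eq_mass:
  assumes "y > 0"
  shows "profile \<alpha> M \<kappa> y = (profile_mass \<alpha> M \<kappa> y / (\<kappa> * y)) powr (1 / (1 - \<alpha>))"
  using assms \<alpha> \<kappa> profile_pos[of y] by (simp add: profile_mass_def powr_powr)

lemma profile_tendsto_0: "(profile \<alpha> M \<kappa> \<longlongrightarrow> 0) at_top"
proof -
  have "filterlim (\<lambda>y. \<kappa> * y) at_top at_top"
    using \<kappa> by (intro filterlim_tendsto_pos_mult_at_top[OF tendsto_const] filterlim_ident)
  then have "((\<lambda>y. profile_mass \<alpha> M \<kappa> y / (\<kappa> * y)) \<longlongrightarrow> 0) at_top"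
    by (intro tendsto_divide_0[OF profile_mass_tendsto] filterlim_at_top_imp_at_infinity)
  moreover have "\<forall>\<^sub>F y in at_top. profile_mass \<alpha> M \<kappa> y / (\<kappa> * y) \<ge> 0"
    using eventually_gt_at_top[of "0::real"]
    by eventually_elim (use \<kappa> profile_mass_pos in \<open>auto simp: less_imp_le\<close>)
  ultimately have "((\<lambda>y. (profile_mass \<alpha> M \<kappa> y / (\<kappa> * y)) powr (1 / (1 - \<alpha>))) \<longlongrightarrow> 0) at_top"
    using \<alpha> by (intro tendsto_zero_powrI[OF _ tendsto_const]) auto
  moreover have "\<forall>\<^sub>F y in at_top. (profile_mass \<alpha> M \<kappa> y / (\<kappa> * y)) powr (1 / (1 - \<alpha>)) = profile \<alpha> M \<kappa> y"
    using eventually_gt_at_top[of "0::real"] by eventually_elim (rule profile_eq_mass[symmetric])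
  ultimately show ?thesis
    by (rule Lim_transform_eventually)
qed

lemma profile_deriv:
  assumes y: "y > 0"
  shows "(profile \<alpha> M \<kappa> has_real_derivative - (profile_slope \<alpha> M \<kappa> y / y)) (at y)"
proof -
  define q where "q = \<alpha> / (1 - \<alpha>)"
  define S where "S y = (\<kappa> * y / M) powr q + 1 / \<kappa>" for y
  have S: "S y > 0" for y
    unfolding S_def q_def by (rule base_pos)
  have z: "\<kappa> * y / M > 0"
    using y \<kappa> M by simp
  have "((\<lambda>y. (\<kappa> * y / M) powr q) has_real_derivative q * (\<kappa> * y / M) powr (q - 1) * (\<kappa> / M)) (at y)"
    using z M by (auto intro!: derivative_eq_intros simp: powr_diff field_simps)
  moreover have "q * (\<kappa> * y / M) powr (q - 1) * (\<kappa> / M) = q * (\<kappa> * y / M) powr q / y"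
  proof -
    have eq: "(\<kappa> * y / M) * (\<kappa> * y / M) powr (q - 1) = (\<kappa> * y / M) powr q"
      using powr_mult_base[of "\<kappa> * y / M" "q - 1"] z by simp
    show ?thesis
      unfolding eq[symmetric] using y by simp
  qed
  ultimately have "((\<lambda>y. (\<kappa> * y / M) powr q) has_real_derivative q * (\<kappa> * y / M) powr q / y) (at y)"
    by (rule DERIV_cong)
  from DERIV_add[OF this DERIV_const, of "1 / \<kappa>"]
  have dS: "(S has_real_derivative q * (\<kappa> * y / M) powr q / y) (at y)"
    unfolding S_def[abs_def] by simp
  have "((\<lambda>y. S y powr (- 1 / \<alpha>)) has_real_derivative
      (- 1 / \<alpha>) * S y powr (- 1 / \<alpha> - 1) * (q * (\<kappa> * y / M) powr q / y)) (at y)"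
    using DERIV_fun_powr[OF dS S, of "- 1 / \<alpha>"] by simp
  moreover have "(- 1 / \<alpha>) * S y powr (- 1 / \<alpha> - 1) * (q * (\<kappa> * y / M) powr q / y) =
      - (profile_slope \<alpha> M \<kappa> y / y)"
    using \<alpha> by (simp add: profile_slope_def S_def q_def)
  ultimately show ?thesis
    by (simp add: profile_def[abs_def] S_def q_def)
qed

end

text \<open>For y > 0 this is the conservation law u_t = - \<kappa> (y u)_y. It is computed from the
  dependence on s alone, which also covers y = 0, where a derivative in y may be missing.\<close>

lemma profile_time_deriv:
  assumes \<alpha>: "0 < \<alpha>" "\<alpha> < 1" and M: "M > 0" and t: "t > 0" and y: "y \<ge> 0"
  shows "((\<lambda>s. profile \<alpha> M (1 / (\<alpha> * s)) y) has_real_derivative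
    - (1 / (\<alpha> * t) * (profile \<alpha> M (1 / (\<alpha> * t)) y - profile_slope \<alpha> M (1 / (\<alpha> * t)) y))) (at t)"
proof -
  define q c where "q = \<alpha> / (1 - \<alpha>)" and "c = (y / (\<alpha> * M)) powr q"
  define S where "S s = c * s powr (- q) + \<alpha> * s" for s
  have c: "c \<ge> 0"
    by (simp add: c_def)
  have S: "S t > 0"
    using t \<alpha> c by (simp add: S_def add_nonneg_pos)
  have base: "(1 / (\<alpha> * s) * y / M) powr q = c * s powr (- q)" if "s > 0" for s
    using that \<alpha> M y by (simp add: c_def powr_divide powr_mult powr_minus field_simps)
  have eq: "profile \<alpha> M (1 / (\<alpha> * s)) y = S s powr (- 1 / \<alpha>)" if "s > 0" for s
    using base[OF that] by (simp add: profile_def S_def q_def)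
  define T where "T = S t powr (- 1 / \<alpha> - 1)"
  have T: "S t powr (- 1 / \<alpha>) = S t * T"
    using powr_mult_base[of "S t" "- 1 / \<alpha> - 1"] S by (simp add: T_def)
  have dS: "(S has_real_derivative c * (- q * t powr (- q) / t) + \<alpha>) (at t)"
    unfolding S_def[abs_def] using t by (auto intro!: derivative_eq_intros simp: powr_diff field_simps)
  have "((\<lambda>s. S s powr (- 1 / \<alpha>)) has_real_derivative
      (- 1 / \<alpha>) * T * (c * (- q * t powr (- q) / t) + \<alpha>)) (at t)"
    unfolding T_def using DERIV_fun_powr[OF dS S, of "- 1 / \<alpha>"] by simp
  moreover have "(- 1 / \<alpha>) * T * (c * (- q * t powr (- q) / t) + \<alpha>) =
      - (1 / (\<alpha> * t) * (S t * T - 1 / (1 - \<alpha>) * (c * t powr (- q)) * T))"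
  proof -
    have q1: "1 / (1 - \<alpha>) = 1 + q"
      using \<alpha> by (simp add: q_def field_simps)
    show ?thesis
      unfolding q1 S_def using t \<alpha> by (simp add: field_simps)
  qed
  moreover have "profile_slope \<alpha> M (1 / (\<alpha> * t)) y = 1 / (1 - \<alpha>) * (c * t powr (- q)) * T"
    using base[OF t] by (simp add: profile_slope_def T_def S_def q_def)
  ultimately have "((\<lambda>s. S s powr (- 1 / \<alpha>)) has_real_derivative
      - (1 / (\<alpha> * t) * (profile \<alpha> M (1 / (\<alpha> * t)) y - profile_slope \<alpha> M (1 / (\<alpha> * t)) y))) (at t)"
    using eq[OF t] T by simp
  then show ?thesis
    by (rule has_field_derivative_transform_within_open[where S = "{0<..}"]) (use t eq in auto)
qed

lemma radial_density_profile:
  fixes u :: "'a::euclidean_space \<Rightarrow> real"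
  defines "\<omega> \<equiv> measure lborel (ball (0::'a) 1)"
  assumes "profile_parameters \<alpha> M \<kappa>" and u: "\<And>x. u x = profile \<alpha> M \<kappa> (\<omega> * norm x ^ DIM('a))"
  shows "radial_density u (\<lambda>r. profile \<alpha> M \<kappa> (\<omega> * r ^ DIM('a)))
    (\<lambda>r. profile_mass \<alpha> M \<kappa> (\<omega> * r ^ DIM('a)))"
proof -
  interpret profile_parameters \<alpha> M \<kappa> by fact
  have \<omega>: "\<omega> > 0"
    unfolding \<omega>_def by (rule unit_ball_measure_pos)
  show ?thesis
  proof
    show "continuous_on {0..} (\<lambda>r. profile \<alpha> M \<kappa> (\<omega> * r ^ DIM('a)))"
      "continuous_on {0..} (\<lambda>r. profile_mass \<alpha> M \<kappa> (\<omega> * r ^ DIM('a)))"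
      using \<omega>
      by (intro continuous_on_compose2[OF profile_cont] continuous_on_compose2[OF profile_mass_cont]
          continuous_intros; auto)+
    fix r :: real assume r: "r > 0"
    have "((\<lambda>r. \<omega> * r ^ DIM('a)) has_real_derivative \<omega> * (DIM('a) * r ^ (DIM('a) - 1))) (at r)"
      by (auto intro!: derivative_eq_intros)
    from DERIV_chain2[OF profile_mass_deriv this]
    show "((\<lambda>r. profile_mass \<alpha> M \<kappa> (\<omega> * r ^ DIM('a))) has_real_derivative
        DIM('a) * measure lborel (ball (0::'a) 1) * r ^ (DIM('a) - 1) * profile \<alpha> M \<kappa> (\<omega> * r ^ DIM('a))) (at r)"
      using r \<omega> by (simp add: \<omega>_def mult_ac)
  qed (use u profile_pos in \<open>auto simp: profile_mass_def zero_power less_imp_le\<close>)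
qed

text \<open>All requirements at a fixed time. The product of u^\<alpha> and u^(1-\<alpha>) makes the
  flux -(\<kappa>/d) u x, whose divergence is the right-hand side of
  \<open>profile_time_deriv\<close> when \<kappa> = 1/(\<alpha> t).\<close>

lemma profile_slice:
  fixes u :: "'a::euclidean_space \<Rightarrow> real"
  assumes params: "profile_parameters \<alpha> M \<kappa>"
    and u: "\<And>x. u x = profile \<alpha> M \<kappa> (measure lborel (ball (0::'a) 1) * norm x ^ DIM('a))"
  defines "G \<equiv> \<lambda>x. - ((\<kappa> / DIM('a) * u x powr (1 - \<alpha>)) *\<^sub>R x)"
  shows "has_bochner_integral lborel u M"
    and "(u \<longlongrightarrow> 0) at_infinity"
    and "\<exists>v. (\<forall>x. GDERIV v x :> G x) \<and> potential_at_infinity u v"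
    and "has_divergence G (- u x) x"
    and "has_divergence (\<lambda>y. (u y powr \<alpha>) *\<^sub>R G y)
      (- (\<kappa> * (u x - profile_slope \<alpha> M \<kappa> (measure lborel (ball (0::'a) 1) * norm x ^ DIM('a))))) x"
proof -
  let ?n = "DIM('a)" and ?\<omega> = "measure lborel (ball (0::'a) 1)"
  let ?f = "\<lambda>r. profile \<alpha> M \<kappa> (?\<omega> * r ^ ?n)"
  interpret profile_parameters \<alpha> M \<kappa> by fact
  interpret radial_density u ?f "\<lambda>r. profile_mass \<alpha> M \<kappa> (?\<omega> * r ^ ?n)" ?\<omega>
    by unfold_locales (use radial_density_profile[OF params u] in \<open>auto simp: radial_density_def\<close>)
  have top: "filterlim (\<lambda>r. ?\<omega> * r ^ ?n) at_top at_top"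
    using omega_pos
    by (intro filterlim_tendsto_pos_mult_at_top[OF tendsto_const] filterlim_pow_at_top filterlim_ident) auto
  show int: "has_bochner_integral lborel u M"
    by (rule has_bochner_integral_of_limit[OF filterlim_compose[OF profile_mass_tendsto top]])
  have "((\<lambda>x::'a. ?f (norm x)) \<longlongrightarrow> 0) at_infinity"
    by (rule filterlim_compose[OF filterlim_compose[OF profile_tendsto_0 top] filterlim_norm_at_top])
  then show "(u \<longlongrightarrow> 0) at_infinity"
    using u by presburger
  \<comment> \<open>The factor y = \<omega> r^d in \<open>profile_mass\<close> cancels against the
    denominator of A.\<close>
  have field: "field x = G x" for x
  proof (cases "x = 0")
    case False
    then have "A (norm x) = \<kappa> / ?n * u x powr (1 - \<alpha>)"
      unfolding A_def unfolding profile_mass_def u using omega_pos by simp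
    then show ?thesis
      by (simp add: field_def G_def)
  qed (simp add: field_def G_def)
  show "\<exists>v. (\<forall>x. GDERIV v x :> G x) \<and> potential_at_infinity u v"
  proof -
    obtain v where "\<And>x. GDERIV v x :> field x" "potential_at_infinity u v"
      using potential_exists int unfolding has_bochner_integral_iff by blast
    then show ?thesis
      unfolding field by blast
  qed
  show "has_divergence G (- u x) x"
  proof -
    have "field = G"
      using field by (rule ext)
    then show ?thesis
      using field_divergence[of x] by simp
  qed
  have "u y powr \<alpha> * u y powr (1 - \<alpha>) = u y" for y
    using profile_pos[of "?\<omega> * norm y ^ ?n"] by (simp add: u flip: powr_add)
  then have flux: "(\<lambda>y. (u y powr \<alpha>) *\<^sub>R G y) = (\<lambda>y. (- (\<kappa> / ?n)) *\<^sub>R (?f (norm y) *\<^sub>R y))"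
    by (auto simp: G_def u mult_ac)
  have "has_divergence (\<lambda>y. ?f (norm y) *\<^sub>R y)
      (?n * (u x - profile_slope \<alpha> M \<kappa> (?\<omega> * norm x ^ ?n))) x"
  proof (cases "x = 0")
    \<comment> \<open>At the origin the slope is 0 because \<open>0 powr\<close> any exponent is 0,
      so only the limit of the profile enters.\<close>
    case True
    have "(?f \<longlongrightarrow> ?f 0) (at 0 within {0..})"
      using f_cont by (simp add: continuous_on_def)
    then have "(?f \<longlongrightarrow> ?f 0) (at_right 0)"
      by (rule tendsto_within_subset) auto
    from has_divergence_radial_0[OF this, where 'a = 'a] show ?thesis
      using True by (simp add: u profile_slope_def zero_power)
  next
    case False
    let ?r = "norm x" and ?y = "?\<omega> * norm x ^ ?n"
    have y: "?y > 0"
      using False omega_pos by simp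
    have "((\<lambda>r. ?\<omega> * r ^ ?n) has_real_derivative ?\<omega> * (?n * ?r ^ (?n - 1))) (at ?r)"
      by (auto intro!: derivative_eq_intros)
    from DERIV_chain2[OF profile_deriv[OF y] this]
    have "(?f has_real_derivative - (profile_slope \<alpha> M \<kappa> ?y / ?y) * (?\<omega> * (?n * ?r ^ (?n - 1)))) (at ?r)" .
    note div = has_divergence_radial[OF False this]
    have y_eq: "?\<omega> * (?r * ?r ^ (?n - 1)) = ?y"
      by (simp only: r_power_DIM[symmetric])
    have "?r * (- (profile_slope \<alpha> M \<kappa> ?y / ?y) * (?\<omega> * (?n * ?r ^ (?n - 1)))) =
        - (?n * profile_slope \<alpha> M \<kappa> ?y * (?\<omega> * (?r * ?r ^ (?n - 1))) / ?y)"
      by simp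
    also have "\<dots> = - (?n * profile_slope \<alpha> M \<kappa> ?y)"
      unfolding y_eq using y False by simp
    finally have slope: "?r * (- (profile_slope \<alpha> M \<kappa> ?y / ?y) * (?\<omega> * (?n * ?r ^ (?n - 1)))) =
        - (?n * profile_slope \<alpha> M \<kappa> ?y)" .
    show ?thesis
      using div unfolding slope by (simp add: u right_diff_distrib)
  qed
  from has_divergence_scaleR[OF this, of "- (\<kappa> / ?n)"]
  show "has_divergence (\<lambda>y. (u y powr \<alpha>) *\<^sub>R G y)
      (- (\<kappa> * (u x - profile_slope \<alpha> M \<kappa> (?\<omega> * norm x ^ ?n)))) x"
    unfolding flux by simp
qed

text \<open>After rescaling space, the density is fixed as \<open>u 1\<close> and time enters only
  through the argument of the test function, which tends to 0 as \<beta> > 0. Dominated convergence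
  with the bound on the test function concludes.\<close>

lemma self_similar_initial_datum:
  fixes u :: "real \<Rightarrow> 'a::euclidean_space \<Rightarrow> real" and \<beta> :: real
  assumes \<beta>: "\<beta> > 0" and M: "M \<ge> 0"
    and ss: "\<And>t x. t > 0 \<Longrightarrow> u t x = t powr (- (DIM('a) * \<beta>)) * F (norm x * t powr (- \<beta>))"
    and int: "has_bochner_integral lborel (u 1) M"
    and meas: "\<And>t. t > 0 \<Longrightarrow> u t \<in> borel_measurable borel"
  shows "has_initial_datum u (scale_measure (ennreal M) (return borel 0))"
  unfolding has_initial_datum_def
proof (intro allI impI)
  fix \<phi> :: "'a \<Rightarrow> real" assume \<phi>: "continuous_on UNIV \<phi> \<and> bounded (range \<phi>)"
  then obtain K where K: "\<And>x. \<bar>\<phi> x\<bar> \<le> K"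
    by (auto simp: bounded_iff)
  have [measurable]: "\<phi> \<in> borel_measurable borel"
    using \<phi> by (auto intro: borel_measurable_continuous_onI)
  have [measurable]: "u 1 \<in> borel_measurable borel"
    by (rule meas) simp
  \<comment> \<open>The Jacobian t^(d\<beta>) of the substitution cancels the prefactor of the
    self-similar form.\<close>
  have scaled: "(LINT x|lborel. \<phi> x * u t x) = (LINT x|lborel. \<phi> ((t powr \<beta>) *\<^sub>R x) * u 1 x)"
    if t: "t > 0" for t
  proof -
    have [measurable]: "u t \<in> borel_measurable borel"
      by (rule meas[OF t])
    have u_scaled: "u t ((t powr \<beta>) *\<^sub>R x) = t powr (- (DIM('a) * \<beta>)) * u 1 x" for x
      using t by (simp add: ss mult_ac flip: powr_add)
    have power: "(t powr \<beta>) ^ DIM('a) = t powr (DIM('a) * \<beta>)"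
      using t by (simp add: powr_realpow[symmetric] powr_powr mult.commute)
    have "(LINT x|lborel. \<phi> x * u t x) =
        (t powr \<beta>) ^ DIM('a) * (LINT x|lborel. \<phi> ((t powr \<beta>) *\<^sub>R x) * u t ((t powr \<beta>) *\<^sub>R x))"
      using t by (intro lborel_integral_scaleR) auto
    also have "(LINT x|lborel. \<phi> ((t powr \<beta>) *\<^sub>R x) * u t ((t powr \<beta>) *\<^sub>R x)) =
        (LINT x|lborel. t powr (- (DIM('a) * \<beta>)) * (\<phi> ((t powr \<beta>) *\<^sub>R x) * u 1 x))"
      by (simp only: u_scaled mult_ac)
    also have "\<dots> = t powr (- (DIM('a) * \<beta>)) * (LINT x|lborel. \<phi> ((t powr \<beta>) *\<^sub>R x) * u 1 x)"
      by (rule integral_mult_right_zero)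
    finally show ?thesis
      unfolding power using t by (simp flip: powr_add mult.assoc)
  qed
  have "((\<lambda>t. LINT x|lborel. \<phi> x * u t x) \<longlongrightarrow> (LINT x|lborel. \<phi> 0 * u 1 x)) (at_right 0)"
  proof (rule tendsto_at_right_sequentially[of 0 1])
    fix S :: "nat \<Rightarrow> real" assume S: "\<And>n. 0 < S n" "S \<longlonglongrightarrow> 0"
    have "(\<lambda>n. LINT x|lborel. \<phi> ((S n powr \<beta>) *\<^sub>R x) * u 1 x) \<longlonglongrightarrow> (LINT x|lborel. \<phi> 0 * u 1 x)"
    proof (rule integral_dominated_convergence[where w = "\<lambda>x. K * \<bar>u 1 x\<bar>"])
      have "(\<lambda>n. S n powr \<beta>) \<longlonglongrightarrow> 0"
        using S \<beta> by (intro tendsto_zero_powrI[OF _ tendsto_const]) (auto intro!: always_eventually less_imp_le)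
      then have "(\<lambda>n. (S n powr \<beta>) *\<^sub>R x) \<longlonglongrightarrow> 0" for x :: 'a
        by (auto intro: tendsto_eq_intros)
      then have "(\<lambda>n. \<phi> ((S n powr \<beta>) *\<^sub>R x)) \<longlonglongrightarrow> \<phi> 0" for x
        using \<phi> by (intro continuous_on_tendsto_compose[of UNIV \<phi>]) auto
      then show "AE x in lborel. (\<lambda>n. \<phi> ((S n powr \<beta>) *\<^sub>R x) * u 1 x) \<longlonglongrightarrow> \<phi> 0 * u 1 x"
        by (intro AE_I2 tendsto_mult_right)
      show "AE x in lborel. norm (\<phi> ((S n powr \<beta>) *\<^sub>R x) * u 1 x) \<le> K * \<bar>u 1 x\<bar>" for n
        using K by (intro AE_I2) (auto simp: abs_mult intro: mult_right_mono)
    qed (use int in \<open>auto simp: has_bochner_integral_iff\<close>)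
    then show "(\<lambda>n. LINT x|lborel. \<phi> x * u (S n) x) \<longlonglongrightarrow> (LINT x|lborel. \<phi> 0 * u 1 x)"
      using S by (simp add: scaled)
  qed simp
  also have "(LINT x|lborel. \<phi> 0 * u 1 x) = (LINT x|scale_measure (ennreal M) (return borel 0). \<phi> x)"
    using int M by (simp add: integral_scaled_point_mass has_bochner_integral_iff)
  finally show "((\<lambda>t. LINT x|lborel. \<phi> x * u t x) \<longlongrightarrow>
      (LINT x|scale_measure (ennreal M) (return borel 0). \<phi> x)) (at_right 0)" .
qed

lemma profile_imp_self_similar_solution:
  fixes u :: "real \<Rightarrow> 'a::euclidean_space \<Rightarrow> real"
  assumes \<alpha>: "0 < \<alpha>" "\<alpha> < 1" and M: "M > 0"
    and u: "\<And>t x. t > 0 \<Longrightarrow> u t x = profile \<alpha> M (1 / (\<alpha> * t)) (measure lborel (ball (0::'a) 1) * norm x ^ DIM('a))"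
  shows "self_similar_solution \<alpha> M u"
proof -
  let ?n = "DIM('a)" and ?\<omega> = "measure lborel (ball (0::'a) 1)"
  \<comment> \<open>Chosen so that (|x| t^(-\<beta>))^d = |x|^d t^(-1/\<alpha>), the combination in
    the explicit formula; F is what then remains of it.\<close>
  define \<beta> where "\<beta> = 1 / (\<alpha> * ?n)"
  define F where "F s = (\<alpha> + (?\<omega> * s ^ ?n / (\<alpha> * M)) powr (\<alpha> / (1 - \<alpha>))) powr (- 1 / \<alpha>)" for s :: real
  have \<beta>: "\<beta> > 0" "?n * \<beta> = 1 / \<alpha>"
    using \<alpha> by (simp_all add: \<beta>_def)
  have params: "profile_parameters \<alpha> M (1 / (\<alpha> * t))" if "t > 0" for t
    using \<alpha> M that by unfold_locales auto
  have formula: "u t x = t powr (- 1 / \<alpha>) *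
      (\<alpha> + (?\<omega> * norm x ^ ?n * t powr (- 1 / \<alpha>) / (\<alpha> * M)) powr (\<alpha> / (1 - \<alpha>))) powr (- 1 / \<alpha>)"
    if "t > 0" for t x
    unfolding u[OF that] by (rule profile_formula) (use \<alpha> M that in auto)
  have ss: "u t x = t powr (- (?n * \<beta>)) * F (norm x * t powr (- \<beta>))" if t: "t > 0" for t x
  proof -
    have "(t powr (- \<beta>)) ^ ?n = t powr (- 1 / \<alpha>)"
      using t \<beta>(2) by (simp add: powr_realpow[symmetric] powr_powr mult.commute)
    then show ?thesis
      unfolding formula[OF t] \<beta>(2) F_def by (simp add: power_mult_distrib mult.assoc)
  qed
  define G where "G t x = - ((1 / (\<alpha> * t) / ?n * u t x powr (1 - \<alpha>)) *\<^sub>R x)" for t x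
  note slice = profile_slice[OF params u, folded G_def]
  have "\<forall>t. \<exists>v. t > 0 \<longrightarrow> (\<forall>x. GDERIV v x :> G t x) \<and> potential_at_infinity (u t) v"
    using slice(3) by blast
  then obtain v where v: "\<And>t. t > 0 \<Longrightarrow> (\<forall>x. GDERIV (v t) x :> G t x) \<and> potential_at_infinity (u t) (v t)"
    by metis
  \<comment> \<open>Joint continuity is read off the explicit formula, where t enters through powers
    and not through the parameter \<kappa>. The outer base is at least \<alpha>, so its negative
    power is continuous.\<close>
  have "continuous_on ({0<..} \<times> UNIV) (\<lambda>(t, x). u t x)"
  proof -
    let ?X = "{0<..} \<times> (UNIV :: 'a set)"
    have time: "continuous_on ?X (\<lambda>p. fst p powr (- 1 / \<alpha>))"
      by (intro continuous_intros) auto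
    have "continuous_on ?X (\<lambda>p. ?\<omega> * norm (snd p) ^ ?n * fst p powr (- 1 / \<alpha>) / (\<alpha> * M))"
      using \<alpha> M by (intro continuous_intros) auto
    from continuous_on_powr'[OF this continuous_on_const]
    have "continuous_on ?X
        (\<lambda>p. (?\<omega> * norm (snd p) ^ ?n * fst p powr (- 1 / \<alpha>) / (\<alpha> * M)) powr (\<alpha> / (1 - \<alpha>)))"
      using \<alpha> M by auto
    then have "continuous_on ?X (\<lambda>p. (\<alpha> +
        (?\<omega> * norm (snd p) ^ ?n * fst p powr (- 1 / \<alpha>) / (\<alpha> * M)) powr (\<alpha> / (1 - \<alpha>))) powr (- 1 / \<alpha>))"
    proof (rule continuous_on_powr[OF continuous_on_add[OF continuous_on_const] continuous_on_const])
      have "\<alpha> + z powr c \<noteq> 0" for z c :: real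
        using \<alpha>(1) by (smt (verit) powr_ge_zero)
      then show "\<forall>p\<in>?X. \<alpha> + (?\<omega> * norm (snd p) ^ ?n * fst p powr (- 1 / \<alpha>) / (\<alpha> * M)) powr (\<alpha> / (1 - \<alpha>)) \<noteq> 0"
        by blast
    qed
    from continuous_on_mult[OF time this] show ?thesis
      by (rule continuous_on_eq) (auto simp: formula)
  qed
  moreover have "\<forall>t>0. (\<forall>x. u t x \<ge> 0) \<and> integrable lborel (u t)"
  proof (intro allI impI conjI)
    fix t :: real and x assume t: "t > 0"
    show "u t x \<ge> 0"
      unfolding u[OF t] by (rule less_imp_le[OF profile_parameters.profile_pos[OF params[OF t]]])
    show "integrable lborel (u t)"
      using slice(1)[OF t t] by (simp add: has_bochner_integral_iff)
  qed
  moreover have "\<exists>D. has_divergence (\<lambda>y. (u t y powr \<alpha>) *\<^sub>R G t y) D x \<and>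
      ((\<lambda>s. u s x) has_real_derivative D) (at t)" if t: "t > 0" for t x
  proof -
    let ?y = "?\<omega> * norm x ^ ?n"
    let ?D = "- (1 / (\<alpha> * t) * (profile \<alpha> M (1 / (\<alpha> * t)) ?y - profile_slope \<alpha> M (1 / (\<alpha> * t)) ?y))"
    have "((\<lambda>s. profile \<alpha> M (1 / (\<alpha> * s)) ?y) has_real_derivative ?D) (at t)"
      by (rule profile_time_deriv) (use \<alpha> M t in auto)
    then have "((\<lambda>s. u s x) has_real_derivative ?D) (at t)"
      by (rule has_field_derivative_transform_within_open[where S = "{0<..}"]) (use t u in auto)
    then show ?thesis
      using slice(5)[OF t t, of x] u[OF t, of x] by metis
  qed
  then have "\<exists>G. \<forall>t>0. \<forall>x. GDERIV (v t) x :> G t x \<and> has_divergence (G t) (- u t x) x \<and>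
        (\<exists>D. has_divergence (\<lambda>y. (u t y powr \<alpha>) *\<^sub>R G t y) D x \<and>
             ((\<lambda>s. u s x) has_real_derivative D) (at t))"
    using v slice(4) by blast
  moreover have "\<forall>t>0. (u t \<longlongrightarrow> 0) at_infinity \<and> potential_at_infinity (u t) (v t)"
    using v slice(2) by blast
  moreover have "has_initial_datum u (scale_measure (ennreal M) (return borel 0))"
  proof (rule self_similar_initial_datum[OF \<beta>(1) _ ss])
    show "has_bochner_integral lborel (u 1) M"
      by (rule slice(1)) auto
    show "u t \<in> borel_measurable borel" if "t > 0" for t
      using slice(1)[OF that that] by (auto simp: has_bochner_integral_iff)
  qed (use M in auto)
  ultimately have "solves_problem \<alpha> (scale_measure (ennreal M) (return borel 0)) u v"
    unfolding solves_problem_def by (intro conjI)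
  moreover have "self_similar u"
    unfolding self_similar_def using ss by blast
  moreover have "\<forall>t>0. (LINT x|lborel. u t x) = M"
    using slice(1) by (auto simp: has_bochner_integral_iff)
  ultimately show ?thesis
    unfolding self_similar_solution_def by blast
qed

theorem mainTheorem1:
  fixes \<alpha> M :: real and u :: "real \<Rightarrow> 'a::euclidean_space \<Rightarrow> real"
  assumes "0 < \<alpha>" and "\<alpha> < 1" and "M > 0"
  shows "self_similar_solution \<alpha> M u \<longleftrightarrow>
    (\<forall>t>0. \<forall>x. u t x =
       t powr (- 1 / \<alpha>) *
       (\<alpha> + (measure lborel (ball (0::'a) 1) * norm x ^ DIM('a) * t powr (- 1 / \<alpha>) / (\<alpha> * M))
              powr (\<alpha> / (1 - \<alpha>))) powr (- 1 / \<alpha>))"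
proof -
  have formula: "profile \<alpha> M (1 / (\<alpha> * t)) (measure lborel (ball (0::'a) 1) * norm x ^ DIM('a)) =
      t powr (- 1 / \<alpha>) *
       (\<alpha> + (measure lborel (ball (0::'a) 1) * norm x ^ DIM('a) * t powr (- 1 / \<alpha>) / (\<alpha> * M))
              powr (\<alpha> / (1 - \<alpha>))) powr (- 1 / \<alpha>)" if "t > 0" for t and x :: 'a
    by (rule profile_formula) (use assms that in auto)
  show ?thesis
    using self_similar_solution_imp_profile[OF assms] profile_imp_self_similar_solution[OF assms] formula
    by metis
qed

end
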